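(* Let $\tilde G$ be a random cyclic $N$-lift of a bipartite graph $G$ with no parallel edges, and let $N_c(\tilde G)$ be the number of cycles of length $c$ in $\tilde G$. As $N$ tends to infinity, for any fixed even $c\ge4$, $$\mathrm{Var}[N_c(\tilde G)]\;\le\;\Big(\frac{c^3}{2}T_1^2+\frac c4T_3^2+\frac c2T_1T_3\Big)N+\mathcal O(1),$$ where $T_1=|\mathcal T_1|$ and $T_3=|\mathcal T_3|$. Here $\mathcal T_1$ is the set of prime zero-permutation TBC walks of length $c$ in $G$, $\mathcal T_2$ is the set of TBC walks of length $c$ in $G$ containing at least one zero-permutation TBC subwalk, and $\mathcal T_3$ is the set of all remaining TBC walks of length $c$ in $G$.
   Context: Graphs are finite. Let $G=(U\cup W,E)$ be bipartite. A cyclic $N$-lift of $G$ is determined by permutation shifts $p_e\in\mathbb Z_N$, $e\in E$: each node $v$ is replaced by $N$ copies $v^0,\dots,v^{N-1}$, and each edge $e=\{u,w\}$ ($u\in U$, $w\in W$) by the $N$ edges $\{u^i,w^{i+p_e \bmod N}\}$, $i\in\mathbb Z_N$. In a random cyclic $N$-lift the $p_e$ are independent and uniform on $\mathbb Z_N$. A cycle is counted once, regardless of starting node and direction. The $\mathcal O(1)$ term is bounded, for all sufficiently large $N$, by a constant independent of $N$ (depending on $G$ and $c$). A TBC (tailless backtrackless closed) walk of length $c$ is a closed walk with edge sequence $e_1,\dots,e_c$ such that $e_s\ne e_{s+1}$ for $1\le s\le c-1$ and $e_1\ne e_c$. TBC walks differing only in the starting point (cyclic shift) or the direction of travel are identified,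 and the sets $\mathcal T_i$ consist of the resulting classes. A TBC subwalk of $w$ is a TBC walk formed by a proper, (cyclically) consecutive subsequence of the steps of $w$. A zero-permutation (ZP) TBC walk is a TBC walk in which each edge is traversed equally many times in both directions. A prime ZP TBC walk is a ZP TBC walk containing no ZP TBC subwalk. *)

theory Defs
  imports "HOL-Probability.Probability" "HOL-Probability.Product_PMF"
begin

text \<open>
  An edge is an unordered pair of vertices and the edges form a set, so parallel edges are
  excluded; loops are excluded because \<open>U\<close> and \<open>W\<close> are disjoint.
\<close>

definition bipartite_graph :: "'a set \<Rightarrow> 'a set \<Rightarrow> 'a set set \<Rightarrow> bool" where
  "bipartite_graph U W E \<longleftrightarrow>
     finite U \<and> finite W \<and> U \<inter> W = {} \<and> E \<subseteq> {{u, w} | u w. u \<in> U \<and> w \<in> W}"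

text \<open>
  A closed walk \<open>v\<^sub>0, v\<^sub>1, \<dots>, v\<^sub>c\<^sub>-\<^sub>1, v\<^sub>0\<close> is represented by the list
  \<open>[v\<^sub>0, \<dots>, v\<^sub>c\<^sub>-\<^sub>1]\<close>, the return to \<open>v\<^sub>0\<close> being implicit; since there are no parallel edges
  the vertices determine the edges.  The list of steps consists of the directed
  traversals \<open>(v\<^sub>0, v\<^sub>1), \<dots>, (v\<^sub>c\<^sub>-\<^sub>1, v\<^sub>0)\<close>.
\<close>

definition walk_steps :: "'a list \<Rightarrow> ('a \<times> 'a) list" where
  "walk_steps xs = zip xs (rotate1 xs)"

definition walk_edges :: "'a list \<Rightarrow> 'a set list" where
  "walk_edges xs = map (\<lambda>(a, b). {a, b}) (walk_steps xs)"

definition closed_walk :: "'a set set \<Rightarrow> 'a list \<Rightarrow> bool" where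
  "closed_walk E xs \<longleftrightarrow> xs \<noteq> [] \<and> set (walk_edges xs) \<subseteq> E"

definition tbc_walk :: "'a set set \<Rightarrow> 'a list \<Rightarrow> bool" where
  "tbc_walk E xs \<longleftrightarrow> closed_walk E xs
     \<and> (\<forall>s. s + 1 < length xs \<longrightarrow> walk_edges xs ! s \<noteq> walk_edges xs ! (s + 1))
     \<and> hd (walk_edges xs) \<noteq> last (walk_edges xs)"

definition tbc_subwalk :: "'a set set \<Rightarrow> 'a list \<Rightarrow> 'a list \<Rightarrow> bool" where
  "tbc_subwalk E ys xs \<longleftrightarrow> tbc_walk E ys \<and>
     (\<exists>r k. k < length xs \<and> walk_steps ys = take k (rotate r (walk_steps xs)))"

definition zero_perm :: "'a list \<Rightarrow> bool" where
  "zero_perm xs \<longleftrightarrow>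
     (\<forall>a b. count_list (walk_steps xs) (a, b) = count_list (walk_steps xs) (b, a))"

definition zp_tbc_walk :: "'a set set \<Rightarrow> 'a list \<Rightarrow> bool" where
  "zp_tbc_walk E xs \<longleftrightarrow> tbc_walk E xs \<and> zero_perm xs"

definition has_zp_tbc_subwalk :: "'a set set \<Rightarrow> 'a list \<Rightarrow> bool" where
  "has_zp_tbc_subwalk E xs \<longleftrightarrow> (\<exists>ys. tbc_subwalk E ys xs \<and> zero_perm ys)"

definition prime_zp_tbc_walk :: "'a set set \<Rightarrow> 'a list \<Rightarrow> bool" where
  "prime_zp_tbc_walk E xs \<longleftrightarrow> zp_tbc_walk E xs \<and> \<not> has_zp_tbc_subwalk E xs"

text \<open>Closed walks up to the choice of the starting point and of the direction of travel.\<close>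

definition walk_equiv :: "('a list \<times> 'a list) set" where
  "walk_equiv = {(xs, ys). \<exists>r. ys = rotate r xs \<or> ys = rotate r (rev xs)}"

definition tbc_classes :: "'a set set \<Rightarrow> nat \<Rightarrow> 'a list set set" where
  "tbc_classes E c = {xs. length xs = c \<and> tbc_walk E xs} // walk_equiv"

definition T1_set :: "'a set set \<Rightarrow> nat \<Rightarrow> 'a list set set" where
  "T1_set E c = {xs. length xs = c \<and> prime_zp_tbc_walk E xs} // walk_equiv"

definition T2_set :: "'a set set \<Rightarrow> nat \<Rightarrow> 'a list set set" where
  "T2_set E c = {xs. length xs = c \<and> tbc_walk E xs \<and> has_zp_tbc_subwalk E xs} // walk_equiv"

definition T3_set :: "'a set set \<Rightarrow> nat \<Rightarrow> 'a list set set" where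
  "T3_set E c = tbc_classes E c - (T1_set E c \<union> T2_set E c)"

definition cycles :: "'a set set \<Rightarrow> nat \<Rightarrow> 'a list set set" where
  "cycles E c = {xs. length xs = c \<and> 3 \<le> c \<and> distinct xs \<and> closed_walk E xs} // walk_equiv"

text \<open>\<open>\<int>\<^sub>N\<close> is represented by \<open>{..<N}\<close>, and the copy \<open>v\<^sup>i\<close> of the vertex \<open>v\<close> by \<open>(v, i)\<close>.\<close>

definition cyclic_lift ::
    "'a set \<Rightarrow> 'a set \<Rightarrow> 'a set set \<Rightarrow> nat \<Rightarrow> ('a set \<Rightarrow> nat) \<Rightarrow> ('a \<times> nat) set set" where
  "cyclic_lift U W E N p =
     {{(u, i), (w, (i + p {u, w}) mod N)} | u w i. u \<in> U \<and> w \<in> W \<and> {u, w} \<in> E \<and> i < N}"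

text \<open>The value \<open>0\<close> is the default outside \<open>E\<close> and plays no role.\<close>

definition random_shifts :: "'a set set \<Rightarrow> nat \<Rightarrow> ('a set \<Rightarrow> nat) pmf" where
  "random_shifts E N = Pi_pmf E 0 (\<lambda>_. pmf_of_set {..<N})"

end

theory Submission
  imports Defs "HOL-Number_Theory.Cong"
begin

text \<open>
  A walk of length \<open>c\<close> in the base graph that lifts to a cycle lifts to exactly one with each of the
  \<open>N\<close> possible starting points.  Hence the number of cycles is \<open>N / (2c)\<close> times the number of lists
  over which some cycle lies.  Those lists are tailless and backtrackless; none of them has a
  zero-permutation subwalk, because that would make the lift revisit a vertex.

  A list in a class of \<open>T3\<close> lifts to a cycle only if a nontrivial linear congruence mod \<open>N\<close> holds for
  the shifts.  As the coefficients form a circulation, at least four of them are nonzero, so one of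
  them is at most \<open>c / 4\<close> in absolute value, and the congruence has probability at most
  \<open>c / (4N)\<close>.  A prime zero-permutation walk fails to lift to a cycle only if one of its at most
  \<open>c\<^sup>2 / 2\<close> closed segments has shift zero; none of these segments is balanced, so each event has
  probability at most \<open>c / N\<close>.

  The number of cycles therefore differs from a constant by \<open>N / (2c) * (D - B)\<close>, where \<open>D\<close> and
  \<open>B\<close> count the lists of the second and the first kind for which the rare event happens.  Both are
  nonnegative, so \<open>(D - B)\<^sup>2 \<le> B\<^sup>2 + D\<^sup>2\<close>; the mixed term only helps, and no additive constant is
  needed.
\<close>

subsection \<open>Closed walks and their equivalence classes\<close>

lemma length_walk_steps [simp]: "length (walk_steps xs) = length xs"
  by (simp add: walk_steps_def)

lemma length_walk_edges [simp]: "length (walk_edges xs) = length xs"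
  by (simp add: walk_edges_def)

lemma nth_walk_steps:
  "k < length xs \<Longrightarrow> walk_steps xs ! k = (xs ! k, xs ! (Suc k mod length xs))"
  by (simp add: walk_steps_def nth_rotate1)

lemma nth_walk_edges:
  "k < length xs \<Longrightarrow> walk_edges xs ! k = {xs ! k, xs ! (Suc k mod length xs)}"
  by (simp add: walk_edges_def nth_walk_steps)

lemma walk_steps_rotate: "walk_steps (rotate r xs) = rotate r (walk_steps xs)"
proof (cases "xs = []")
  case False
  show ?thesis
  proof (rule nth_equalityI)
    fix k assume "k < length (walk_steps (rotate r xs))"
    then have k: "k < length xs" by simp
    have "Suc ((r + k) mod length xs) mod length xs = (r + Suc k mod length xs) mod length xs"
      by (simp add: mod_simps)
    with k False show "walk_steps (rotate r xs) ! k = rotate r (walk_steps xs) ! k"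
      by (simp add: nth_walk_steps nth_rotate)
  qed simp
qed (simp add: walk_steps_def)

lemma closed_walk_iff:
  "closed_walk E xs \<longleftrightarrow>
     xs \<noteq> [] \<and> (\<forall>k < length xs. {xs ! k, xs ! (Suc k mod length xs)} \<in> E)"
  unfolding closed_walk_def subset_iff in_set_conv_nth
  by (auto simp: nth_walk_edges)

lemma closed_walk_rotate:
  assumes "closed_walk E xs" shows "closed_walk E (rotate r xs)"
  using assms by (simp add: closed_walk_def walk_edges_def walk_steps_rotate flip: rotate_map)

lemma closed_walk_rev:
  assumes "closed_walk E xs" shows "closed_walk E (rev xs)"
  unfolding closed_walk_iff
proof (intro conjI allI impI)
  show "rev xs \<noteq> []" using assms by (simp add: closed_walk_def)
  fix k assume "k < length (rev xs)"
  then have k: "k < length xs" by simp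
  let ?n = "length xs"
  \<comment> \<open>Step \<open>k\<close> of the reversed walk undoes step \<open>l\<close> of the
    original one; the closing step, \<open>Suc k = ?n\<close>, undoes the closing step.\<close>
  define l where "l = (if Suc k = ?n then ?n - 1 else ?n - Suc (Suc k))"
  have l: "l < ?n" using k by (auto simp: l_def)
  have Suc_l: "Suc l mod ?n = (if Suc k = ?n then 0 else ?n - Suc k)"
    using k by (cases ?n) (auto simp: l_def Suc_diff_Suc)
  have "{xs ! l, xs ! (Suc l mod ?n)} \<in> E" using assms l by (simp add: closed_walk_iff)
  moreover have "rev xs ! k = xs ! (Suc l mod ?n)"
    using k by (simp add: Suc_l rev_nth)
  moreover have "rev xs ! (Suc k mod ?n) = xs ! l"
    using k by (subst rev_nth) (auto simp: l_def Suc_lessI intro!: mod_less_divisor)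
  ultimately show "{rev xs ! k, rev xs ! (Suc k mod length (rev xs))} \<in> E"
    by (simp add: insert_commute)
qed

lemma rotate_invertible: "\<exists>s. rotate s (rotate r xs) = xs"
proof -
  \<comment> \<open>The two rotations add up to a multiple of the length. For nonempty
    \<open>xs\<close> the subtraction is not truncated.\<close>
  have "rotate (length xs * r - r) (rotate r xs) = rotate (length xs * r) xs" if "xs \<noteq> []"
    using that by (simp add: rotate_rotate Suc_leI)
  then have "rotate (length xs * r - r) (rotate r xs) = xs" if "xs \<noteq> []"
    using that by (simp add: rotate_id)
  then show ?thesis by (cases "xs = []") auto
qed

lemma rotate_rev_ex: "\<exists>s. rotate r (rev xs) = rev (rotate s xs)"
  using rotate_rev by blast

lemma equiv_walk_equiv: "equiv UNIV walk_equiv"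
proof (rule equivI)
  show "refl walk_equiv" by (auto simp: refl_on_def walk_equiv_def intro: exI[of _ 0])
next
  show "sym walk_equiv"
    unfolding sym_def walk_equiv_def
    by clarsimp (metis rev_rev_ident rotate_invertible rotate_rev_ex)
next
  show "trans walk_equiv"
    unfolding trans_def walk_equiv_def
    by clarsimp (metis rev_rev_ident rotate_rotate rotate_rev_ex)
qed auto

text \<open>Rotations act modulo the length, so a class consists of two orbits of at most
  \<open>length xs\<close> lists each. Both the general bound on the size of a class and the exact
  size for distinct lists come from this.\<close>

lemma walk_class_eq:
  "walk_equiv `` {xs} = (\<lambda>r. rotate r xs) ` {..<length xs} \<union> (\<lambda>r. rotate r (rev xs)) ` {..<length xs}"
  if "xs \<noteq> []"
proof -
  have *: "rotate r ys = rotate (r mod length ys) ys" for r and ys :: "'a list"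
    by (rule rotate_conv_mod)
  have "r mod length xs < length xs" for r using that by simp
  then show ?thesis
    unfolding walk_equiv_def Image_singleton
    by (auto simp: image_iff) (metis * lessThan_iff length_rev)+
qed

lemma finite_walk_class: "finite (walk_equiv `` {xs})" if "xs \<noteq> []"
  by (simp add: walk_class_eq[OF that])

lemma card_walk_class_le: "card (walk_equiv `` {xs}) \<le> 2 * length xs" if "xs \<noteq> []"
proof -
  have "card (walk_equiv `` {xs}) \<le>
     card ((\<lambda>r. rotate r xs) ` {..<length xs}) + card ((\<lambda>r. rotate r (rev xs)) ` {..<length xs})"
    by (simp add: walk_class_eq[OF that] card_Un_le)
  also have "\<dots> \<le> length xs + length xs"
    by (intro add_mono order.trans[OF card_image_le]) auto
  finally show ?thesis by simp
qed

lemma inj_on_rotate: "distinct xs \<Longrightarrow> inj_on (\<lambda>r. rotate r xs) {..<length xs}"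
proof (rule inj_onI)
  fix r s assume d: "distinct xs" "r \<in> {..<length xs}" "s \<in> {..<length xs}" "rotate r xs = rotate s xs"
  then have "rotate r xs ! 0 = rotate s xs ! 0" by simp
  moreover have "0 < length xs" using d by auto
  ultimately have "xs ! r = xs ! s"
    using d nth_rotate[of 0 xs r] nth_rotate[of 0 xs s] by simp
  with d show "r = s" by (simp add: nth_eq_iff_index_eq)
qed

text \<open>Comparing positions \<open>k\<close>, a coincidence forces r + s + 2k + 1 to vanish
  modulo the length n. The cases k = 0 and k = 1 then give that n divides 2, against n >= 3.\<close>

lemma rotate_neq_rotate_rev:
  assumes "distinct xs" "3 \<le> length xs"
  shows "rotate r xs \<noteq> rotate s (rev xs)"
proof
  let ?n = "length xs"
  assume eq: "rotate r xs = rotate s (rev xs)"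
  have "(r + k) mod ?n = ?n - Suc ((s + k) mod ?n)" if "k < ?n" for k
  proof -
    have "rotate r xs ! k = xs ! ((r + k) mod ?n)" using that by (simp add: nth_rotate)
    moreover have "rotate s (rev xs) ! k = xs ! (?n - Suc ((s + k) mod ?n))"
      using that by (subst nth_rotate) (auto intro!: rev_nth mod_less_divisor)
    moreover have "(r + k) mod ?n < ?n" "?n - Suc ((s + k) mod ?n) < ?n"
      using that by (auto intro!: mod_less_divisor)
    ultimately show ?thesis using eq assms by (metis nth_eq_iff_index_eq)
  qed
  note reflect = this
  have *: "int ((r + k) mod ?n) + int ((s + k) mod ?n) + 1 = int ?n" if "k < ?n" for k
  proof -
    have "(s + k) mod ?n < ?n" using that by (intro mod_less_divisor) linarith
    moreover have "(r + k) mod ?n = ?n - Suc ((s + k) mod ?n)" by (rule reflect[OF that])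
    ultimately show ?thesis by linarith
  qed
  have "[int r + int k + (int s + int k) + 1 = 0] (mod int ?n)" if "k < ?n" for k
  proof -
    have "[int r + int k + (int s + int k) + 1 = int ((r + k) mod ?n) + int ((s + k) mod ?n) + 1] (mod int ?n)"
      by (intro cong_add) (auto simp: cong_def zmod_int)
    then show ?thesis using *[OF that] by (simp add: cong_def)
  qed
  from this[of 0] this[of 1] have "[int r + int s + 1 = 0] (mod int ?n)" "[int r + int s + 3 = 0] (mod int ?n)"
    using assms(2) by (simp_all flip: length_greater_0_conv add: algebra_simps)
  then have "int ?n dvd int r + int s + 1" "int ?n dvd int r + int s + 3"
    by (simp_all only: cong_0_iff)
  then have "int ?n dvd 2" using dvd_diff[of "int ?n" "int r + int s + 3" "int r + int s + 1"] by simp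
  then show False using assms zdvd_imp_le by fastforce
qed

lemma card_walk_class:
  assumes "distinct xs" "3 \<le> length xs"
  shows "card (walk_equiv `` {xs}) = 2 * length xs"
proof -
  have "xs \<noteq> []" using assms by auto
  moreover have "(\<lambda>r. rotate r xs) ` {..<length xs} \<inter> (\<lambda>r. rotate r (rev xs)) ` {..<length xs} = {}"
    using rotate_neq_rotate_rev[OF assms] by auto
  moreover have "inj_on (\<lambda>r. rotate r (rev xs)) {..<length xs}"
    using inj_on_rotate[of "rev xs"] assms by simp
  ultimately show ?thesis
    using inj_on_rotate[OF assms(1)] by (simp add: walk_class_eq card_Un_disjoint card_image)
qed

lemma distinct_closed_walk_equiv:
  assumes "(xs, ys) \<in> walk_equiv" "distinct xs" "closed_walk E xs"
  shows "distinct ys \<and> closed_walk E ys \<and> length ys = length xs"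
  using assms by (auto simp: walk_equiv_def closed_walk_rotate closed_walk_rev)

text \<open>On lists without repetition the rotations and reflections act freely, so every class has
  exactly 2c members. This replaces counting cycles by counting lists.\<close>

lemma card_cycles:
  fixes E :: "'a set set"
  assumes "finite {xs :: 'a list. length xs = c \<and> distinct xs \<and> closed_walk E xs}" "3 \<le> c"
  shows "2 * c * card (cycles E c) = card {xs. length xs = c \<and> distinct xs \<and> closed_walk E xs}"
proof -
  let ?L = "{xs. length xs = c \<and> distinct xs \<and> closed_walk E xs}"
  have cyc: "cycles E c = ?L // walk_equiv" using assms by (simp add: cycles_def)
  have sub: "walk_equiv `` {xs} \<subseteq> ?L" if "xs \<in> ?L" for xs
    using that distinct_closed_walk_equiv by blast
  have Un: "\<Union> (?L // walk_equiv) = ?L"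
  proof
    show "\<Union> (?L // walk_equiv) \<subseteq> ?L" using sub unfolding quotient_def by blast
    show "?L \<subseteq> \<Union> (?L // walk_equiv)"
      unfolding quotient_def using equiv_class_self[OF equiv_walk_equiv] by blast
  qed
  have "2 * c * card (?L // walk_equiv) = card (\<Union> (?L // walk_equiv))"
  proof (rule card_partition)
    show "finite (?L // walk_equiv)" unfolding quotient_def using assms(1) by simp
    show "finite (\<Union> (?L // walk_equiv))" using Un assms(1) by simp
    show "card X = 2 * c" if "X \<in> ?L // walk_equiv" for X
      using that assms(2) by (auto elim!: quotientE simp: card_walk_class)
    show "X \<inter> Y = {}" if "X \<in> ?L // walk_equiv" "Y \<in> ?L // walk_equiv" "X \<noteq> Y" for X Y
      using that quotient_disj[OF equiv_walk_equiv] quotient_def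
      by (metis (no_types, lifting) UNIV_I equiv_class_eq_iff equiv_walk_equiv quotientE quotientI)
  qed
  then show ?thesis by (simp add: cyc Un)
qed

subsection \<open>Shifts along walks\<close>

text \<open>The side \<open>U\<close> orients each edge; traversing it from the other side subtracts
  the shift. Values are integers, so opposite traversals cancel exactly and reduction modulo N is
  left to the congruences.\<close>

definition step_shift :: "'a set \<Rightarrow> ('a set \<Rightarrow> nat) \<Rightarrow> 'a \<times> 'a \<Rightarrow> int" where
  "step_shift U p s = (if fst s \<in> U then int (p {fst s, snd s}) else - int (p {fst s, snd s}))"

lemma edgeE:
  assumes "bipartite_graph U W E" "e \<in> E"
  obtains u w where "e = {u, w}" "u \<in> U" "w \<in> W" "w \<notin> U"
proof -
  obtain u w where "e = {u, w}" "u \<in> U" "w \<in> W"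
    using assms by (auto simp: bipartite_graph_def)
  moreover from this have "w \<notin> U" using assms by (auto simp: bipartite_graph_def)
  ultimately show thesis using that by blast
qed

text \<open>The lift is defined from the \<open>U\<close> side only. The signed shift makes
  adjacency one congruence valid for both directions of travel.\<close>

lemma mem_cyclic_lift_iff:
  assumes "bipartite_graph U W E"
  shows "{(a, i), (b, j)} \<in> cyclic_lift U W E N p \<longleftrightarrow>
           {a, b} \<in> E \<and> i < N \<and> j < N \<and> [int j = int i + step_shift U p (a, b)] (mod int N)"
    (is "?l \<longleftrightarrow> ?r")
proof
  have disj: "U \<inter> W = {}" using assms by (simp add: bipartite_graph_def)
  {
    assume ?l
    then obtain u w k where *: "{(a, i), (b, j)} = {(u, k), (w, (k + p {u, w}) mod N)}"
        "u \<in> U" "w \<in> W" "{u, w} \<in> E" "k < N"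
      unfolding cyclic_lift_def by blast
    have "w \<notin> U" using disj * by auto
    from *(1) consider
        "a = u" "i = k" "b = w" "j = (k + p {u, w}) mod N"
      | "b = u" "j = k" "a = w" "i = (k + p {u, w}) mod N"
      by (auto simp: doubleton_eq_iff)
    then show ?r
    proof cases
      case 1
      then show ?thesis using * by (simp add: step_shift_def cong_def zmod_int)
    next
      \<comment> \<open>Here the step runs from \<open>W\<close> to \<open>U\<close>, so the
        definition gives \<open>i\<close> in terms of \<open>j\<close> and has to be solved for
        \<open>j\<close>.\<close>
      case 2
      have "[int ((k + p {u, w}) mod N) - int (p {u, w}) = int (k + p {u, w}) - int (p {u, w})] (mod int N)"
        by (intro cong_diff) (auto simp: cong_def zmod_int)
      then have "[int j = int i - int (p {u, w})] (mod int N)"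
        using 2 by (simp add: cong_def)
      then show ?thesis using * 2 \<open>w \<notin> U\<close>
        by (simp add: step_shift_def insert_commute)
    qed
  }
  assume r: ?r
  then have "{a, b} \<in> E" by simp
  then obtain u w where uw: "{a, b} = {u, w}" "u \<in> U" "w \<in> W" "w \<notin> U"
    by (rule edgeE[OF assms])
  consider "a = u" "b = w" | "a = w" "b = u" using uw(1) by (auto simp: doubleton_eq_iff)
  then show ?l
  proof cases
    case 1
    then have "[int j = int (i + p {u, w})] (mod int N)" using r uw by (simp add: step_shift_def)
    then have "[j = i + p {u, w}] (mod N)" by (simp only: cong_int_iff)
    then have "j = (i + p {u, w}) mod N" using r by (simp add: cong_def)
    then show ?thesis unfolding cyclic_lift_def using r uw 1 by blast
  next
    case 2
    then have "[int j + int (p {u, w}) = int i - int (p {u, w}) + int (p {u, w})] (mod int N)"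
      using r uw by (intro cong_add) (auto simp: step_shift_def insert_commute)
    then have "[int i = int (j + p {u, w})] (mod int N)" by (simp add: cong_def)
    then have "[i = j + p {u, w}] (mod N)" by (simp only: cong_int_iff)
    then have "i = (j + p {u, w}) mod N" using r by (simp add: cong_def)
    then have "{(u, j), (w, i)} \<in> cyclic_lift U W E N p"
      unfolding cyclic_lift_def using r uw 2 by (auto simp: insert_commute)
    then show ?thesis using 2 by (simp add: insert_commute)
  qed
qed

text \<open>A closed walk in the lift splits into its projection to the base graph and a compatible
  sequence of layers. The definition of the lift is not unfolded again after this.\<close>

lemma closed_walk_lift_iff:
  assumes "bipartite_graph U W E"
  shows "closed_walk (cyclic_lift U W E N p) zs \<longleftrightarrow>
    closed_walk E (map fst zs) \<and>
    (\<forall>k < length zs. snd (zs ! k) < N \<and>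
       [int (snd (zs ! (Suc k mod length zs))) =
          int (snd (zs ! k)) + step_shift U p (walk_steps (map fst zs) ! k)] (mod int N))"
proof -
  let ?n = "length zs"
  have edge: "{zs ! k, zs ! (Suc k mod ?n)} \<in> cyclic_lift U W E N p \<longleftrightarrow>
     {fst (zs ! k), fst (zs ! (Suc k mod ?n))} \<in> E \<and> snd (zs ! k) < N \<and>
     snd (zs ! (Suc k mod ?n)) < N \<and>
     [int (snd (zs ! (Suc k mod ?n))) =
          int (snd (zs ! k)) + step_shift U p (walk_steps (map fst zs) ! k)] (mod int N)"
    if "k < ?n" for k
  proof -
    have "Suc k mod ?n < ?n" using that by (intro mod_less_divisor) linarith
    with that have "walk_steps (map fst zs) ! k = (fst (zs ! k), fst (zs ! (Suc k mod ?n)))"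
      by (simp add: nth_walk_steps)
    then show ?thesis
      using mem_cyclic_lift_iff[OF assms, of "fst (zs ! k)" "snd (zs ! k)"
          "fst (zs ! (Suc k mod ?n))" "snd (zs ! (Suc k mod ?n))"] by simp
  qed
  have lt: "Suc k mod ?n < ?n" if "k < ?n" for k using that by (intro mod_less_divisor) linarith
  show ?thesis
    unfolding closed_walk_iff using edge lt
    by (auto simp: nth_map)
qed

section \<open>Net flow of a step list and balanced step lists\<close>

text \<open>This signed number of traversals is the coefficient of the shift of \<open>e\<close> in
  the total shift of the steps.\<close>

definition net_flow :: "'a set \<Rightarrow> ('a \<times> 'a) list \<Rightarrow> 'a set \<Rightarrow> int" where
  "net_flow U st e = (\<Sum>s\<leftarrow>st. if {fst s, snd s} = e then (if fst s \<in> U then 1 else - 1) else 0)"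

text \<open>Collecting the steps by edge turns the total shift into a linear form in the independent
  variables \<open>p e\<close>, the shape needed for the probability bounds.\<close>

lemma sum_shift_eq:
  assumes "finite E" "\<forall>s \<in> set st. {fst s, snd s} \<in> E"
  shows "(\<Sum>s\<leftarrow>st. step_shift U p s) = (\<Sum>e\<in>E. net_flow U st e * int (p e))"
  using assms(2)
proof (induction st)
  case (Cons s st)
  have "(\<Sum>e\<in>E. net_flow U (s # st) e * int (p e)) =
      (\<Sum>e\<in>E. (if {fst s, snd s} = e then (if fst s \<in> U then 1 else - 1) * int (p e) else 0)
              + net_flow U st e * int (p e))"
    by (intro sum.cong) (auto simp: net_flow_def algebra_simps)
  also have "\<dots> = step_shift U p s + (\<Sum>e\<in>E. net_flow U st e * int (p e))"
    using Cons.prems assms(1) by (simp add: sum.distrib step_shift_def)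
  finally show ?case using Cons by simp
qed (simp add: net_flow_def)

lemma net_flow_eq:
  assumes "u \<in> U" "w \<notin> U"
  shows "net_flow U st {u, w} = int (count_list st (u, w)) - int (count_list st (w, u))"
proof (induction st)
  case (Cons s st)
  have "net_flow U (s # st) {u, w} =
      (if s = (u, w) then 1 else if s = (w, u) then - 1 else 0) + net_flow U st {u, w}"
    using assms by (cases s) (auto simp: net_flow_def doubleton_eq_iff)
  moreover have "u \<noteq> w" using assms by auto
  ultimately show ?case by (simp add: Cons.IH)
qed (simp add: net_flow_def)

lemma abs_net_flow_le: "\<bar>net_flow U st e\<bar> \<le> int (length st)"
proof (induction st)
  case (Cons s st)
  then show ?case by (auto simp: net_flow_def)
qed (simp add: net_flow_def)

text \<open>The condition \<open>zero_perm\<close>, stated for arbitrary step lists so that it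
  applies to segments of a walk, which need not be tailless.\<close>

definition balanced :: "('a \<times> 'a) list \<Rightarrow> bool" where
  "balanced st \<longleftrightarrow> (\<forall>a b. count_list st (a, b) = count_list st (b, a))"

lemma zero_perm_iff_balanced: "zero_perm xs \<longleftrightarrow> balanced (walk_steps xs)"
  by (simp add: zero_perm_def balanced_def)

lemma edge_distinct:
  assumes "bipartite_graph U W E" "{a, b} \<in> E"
  shows "a \<noteq> b"
  by (rule edgeE[OF assms]) (auto simp: doubleton_eq_iff)

lemma finite_edges: "bipartite_graph U W E \<Longrightarrow> finite E"
proof -
  assume *: "bipartite_graph U W E"
  then have "E \<subseteq> (\<lambda>(u, w). {u, w}) ` (U \<times> W)" by (auto simp: bipartite_graph_def)
  with * show "finite E" by (meson bipartite_graph_def finite_SigmaI finite_imageI finite_subset)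
qed

text \<open>Balanced step lists are those whose total shift is the zero linear form. An unbalanced
  segment therefore has a nonzero coefficient, which is what makes a zero shift unlikely.\<close>

lemma balanced_iff_net_flow:
  assumes "bipartite_graph U W E" "\<forall>s \<in> set st. {fst s, snd s} \<in> E"
  shows "balanced st \<longleftrightarrow> (\<forall>e\<in>E. net_flow U st e = 0)"
proof
  assume "balanced st"
  then show "\<forall>e\<in>E. net_flow U st e = 0"
    by (auto elim!: edgeE[OF assms(1)] simp: balanced_def net_flow_eq)
next
  assume *: "\<forall>e\<in>E. net_flow U st e = 0"
  show "balanced st"
    unfolding balanced_def
  proof (intro allI)
    fix a b
    show "count_list st (a, b) = count_list st (b, a)"
    proof (cases "{a, b} \<in> E")
      case True
      obtain u w where uw: "{a, b} = {u, w}" "u \<in> U" "w \<notin> U"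
        by (rule edgeE[OF assms(1) True])
      then have "count_list st (u, w) = count_list st (w, u)"
        using * True net_flow_eq[OF uw(2,3), of st] by simp
      then show ?thesis using uw(1) by (auto simp: doubleton_eq_iff)
    next
      case False
      then have "(a, b) \<notin> set st" "(b, a) \<notin> set st" using assms(2) by (auto simp: insert_commute)
      then show ?thesis by (simp add: count_list_0_iff)
    qed
  qed
qed

lemma balanced_sum_shift:
  assumes "bipartite_graph U W E" "\<forall>s \<in> set st. {fst s, snd s} \<in> E" "balanced st"
  shows "(\<Sum>s\<leftarrow>st. step_shift U p s) = 0"
  using assms balanced_iff_net_flow[OF assms(1,2)] sum_shift_eq[OF finite_edges assms(2)]
  by simp

lemma closed_walk_steps_in:
  assumes "closed_walk E xs"
  shows "\<forall>s \<in> set (walk_steps xs). {fst s, snd s} \<in> E"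
  using assms by (auto simp: closed_walk_def walk_edges_def case_prod_beta)

text \<open>The starting layer and the partial sums of shifts determine all layers. Reducing the
  index modulo the length admits \<open>j = length zs\<close>, which expresses that the lift closes
  up.\<close>

lemma lift_snd_cong:
  assumes "bipartite_graph U W E" "closed_walk (cyclic_lift U W E N p) zs" "j \<le> length zs"
  shows "[int (snd (zs ! (j mod length zs))) = int (snd (zs ! 0)) +
            (\<Sum>s\<leftarrow>take j (walk_steps (map fst zs)). step_shift U p s)] (mod int N)"
  using assms(3)
proof (induction j)
  case (Suc j)
  let ?st = "walk_steps (map fst zs)"
  have j: "j < length zs" using Suc by simp
  have "[int (snd (zs ! (Suc j mod length zs))) = int (snd (zs ! j)) + step_shift U p (?st ! j)] (mod int N)"
    using assms(2) j unfolding closed_walk_lift_iff[OF assms(1)] by blast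
  moreover have "[int (snd (zs ! j)) + step_shift U p (?st ! j) =
      int (snd (zs ! 0)) + (\<Sum>s\<leftarrow>take j ?st. step_shift U p s) + step_shift U p (?st ! j)] (mod int N)"
    using Suc j by (intro cong_add) auto
  ultimately have "[int (snd (zs ! (Suc j mod length zs))) =
      int (snd (zs ! 0)) + (\<Sum>s\<leftarrow>take j ?st. step_shift U p s) + step_shift U p (?st ! j)] (mod int N)"
    by (rule cong_trans)
  then show ?case using j by (simp add: take_Suc_conv_app_nth add.assoc)
qed simp

subsection \<open>Walks that lift to cycles\<close>

definition has_cycle_lift ::
    "'a set \<Rightarrow> 'a set \<Rightarrow> 'a set set \<Rightarrow> nat \<Rightarrow> ('a set \<Rightarrow> nat) \<Rightarrow> 'a list \<Rightarrow> bool" where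
  "has_cycle_lift U W E N p xs \<longleftrightarrow>
     (\<exists>zs. map fst zs = xs \<and> distinct zs \<and> closed_walk (cyclic_lift U W E N p) zs)"

lemma has_cycle_lift_equiv:
  assumes "(xs, ys) \<in> walk_equiv" "has_cycle_lift U W E N p xs"
  shows "has_cycle_lift U W E N p ys"
proof -
  obtain zs where zs: "map fst zs = xs" "distinct zs" "closed_walk (cyclic_lift U W E N p) zs"
    using assms(2) by (auto simp: has_cycle_lift_def)
  from assms(1) consider r where "ys = rotate r xs" | r where "ys = rotate r (rev xs)"
    by (auto simp: walk_equiv_def)
  then show ?thesis
  proof cases
    case 1
    then show ?thesis unfolding has_cycle_lift_def
      using zs closed_walk_rotate by (intro exI[of _ "rotate r zs"]) (auto simp: rotate_map)
  next
    case 2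
    then show ?thesis unfolding has_cycle_lift_def
      using zs
      by (intro exI[of _ "rotate r (rev zs)"])
        (auto simp: rotate_map rev_map intro: closed_walk_rotate closed_walk_rev)
  qed
qed

section \<open>Conditions forced on a walk by a cycle above it\<close>

text \<open>A tail is a backtracking at the wrap-around index, so a cyclic successor covers both
  conditions at once.\<close>

lemma tbc_walk_iff:
  "tbc_walk E xs \<longleftrightarrow> closed_walk E xs \<and>
     (\<forall>k < length xs. walk_edges xs ! k \<noteq> walk_edges xs ! (Suc k mod length xs))"
proof (cases "xs = []")
  case False
  then have ne: "walk_edges xs \<noteq> []" by (metis length_walk_edges length_0_conv)
  let ?n = "length xs"
  have *: "hd (walk_edges xs) = walk_edges xs ! 0" "last (walk_edges xs) = walk_edges xs ! (?n - 1)"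
    using ne by (simp_all add: hd_conv_nth last_conv_nth)
  have n: "Suc (?n - 1) = ?n" using False by simp
  show ?thesis
    unfolding tbc_walk_def *
  proof (intro conj_cong refl iffI conjI allI impI)
    fix k assume *: "(\<forall>s. s + 1 < ?n \<longrightarrow> walk_edges xs ! s \<noteq> walk_edges xs ! (s + 1)) \<and>
      walk_edges xs ! 0 \<noteq> walk_edges xs ! (?n - 1)" and k: "k < ?n"
    show "walk_edges xs ! k \<noteq> walk_edges xs ! (Suc k mod ?n)"
    proof (cases "Suc k = ?n")
      case True
      then have "k = ?n - 1" by simp
      with * show ?thesis by (metis True mod_self)
    next
      case False
      then have "Suc k < ?n" using k by simp
      with * show ?thesis by (metis Suc_eq_plus1 mod_less)
    qed
  next
    fix s assume "\<forall>k < ?n. walk_edges xs ! k \<noteq> walk_edges xs ! (Suc k mod ?n)" "s + 1 < ?n"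
    then show "walk_edges xs ! s \<noteq> walk_edges xs ! (s + 1)"
      by (metis Suc_eq_plus1 Suc_lessD mod_less)
  next
    assume "\<forall>k < ?n. walk_edges xs ! k \<noteq> walk_edges xs ! (Suc k mod ?n)"
    then show "walk_edges xs ! 0 \<noteq> walk_edges xs ! (?n - 1)"
      using n by (metis lessI mod_self)
  qed
qed (auto simp: tbc_walk_def closed_walk_def)

lemma shift_reverse:
  assumes "bipartite_graph U W E" "{a, b} \<in> E"
  shows "step_shift U p (b, a) = - step_shift U p (a, b)"
proof -
  obtain u w where "{a, b} = {u, w}" "u \<in> U" "w \<notin> U" by (rule edgeE[OF assms])
  then show ?thesis by (auto simp: step_shift_def doubleton_eq_iff insert_commute)
qed

lemma cong_less_imp_eq:
  assumes "[int i = int j] (mod int N)" "i < N" "j < N"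
  shows "i = j"
  using assms by (simp add: cong_def flip: zmod_int)

text \<open>Going along an edge and straight back cancels the shift and returns to the same copy of
  the vertex. The lift would then repeat a vertex at two positions that differ because the length is
  at least 3.\<close>

lemma tbc_walk_if_cycle_lift:
  assumes G: "bipartite_graph U W E" and lift: "has_cycle_lift U W E N p xs"
    and len: "3 \<le> length xs"
  shows "tbc_walk E xs"
proof -
  obtain zs where zs: "map fst zs = xs" "distinct zs" "closed_walk (cyclic_lift U W E N p) zs"
    using lift by (auto simp: has_cycle_lift_def)
  let ?n = "length xs"
  have n: "length zs = ?n" using zs(1) by auto
  note cl = zs(3)[unfolded closed_walk_lift_iff[OF G] zs(1) n]
  have "walk_edges xs ! k \<noteq> walk_edges xs ! (Suc k mod ?n)" if k: "k < ?n" for k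
  proof
    define l where "l = Suc k mod ?n"
    define m where "m = Suc l mod ?n"
    have lt: "l < ?n" "m < ?n" using len by (auto simp: l_def m_def intro!: mod_less_divisor)
    have km: "k \<noteq> m" using k len by (auto simp: l_def m_def mod_Suc)
    assume "walk_edges xs ! k = walk_edges xs ! (Suc k mod ?n)"
    then have eq: "{xs ! k, xs ! l} = {xs ! l, xs ! m}"
      using k lt by (simp add: nth_walk_edges flip: l_def m_def)
    have e: "{xs ! k, xs ! l} \<in> E"
      using cl k by (auto simp: closed_walk_iff l_def)
    have xkm: "xs ! k = xs ! m" using eq edge_distinct[OF G e] by (auto simp: doubleton_eq_iff)
    have "[int (snd (zs ! l)) = int (snd (zs ! k)) + step_shift U p (xs ! k, xs ! l)] (mod int N)"
      using cl k by (auto simp: l_def nth_walk_steps)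
    moreover have "[int (snd (zs ! m)) = int (snd (zs ! l)) + step_shift U p (xs ! l, xs ! k)] (mod int N)"
      using cl lt by (auto simp: m_def nth_walk_steps xkm)
    ultimately have "[int (snd (zs ! m)) + int (snd (zs ! l)) =
        int (snd (zs ! l)) + step_shift U p (xs ! l, xs ! k) + (int (snd (zs ! k)) + step_shift U p (xs ! k, xs ! l))] (mod int N)"
      by (intro cong_add)
    then have "[int (snd (zs ! l)) + int (snd (zs ! m)) = int (snd (zs ! l)) + int (snd (zs ! k))] (mod int N)"
      by (simp add: shift_reverse[OF G e] algebra_simps)
    then have "[int (snd (zs ! m)) = int (snd (zs ! k))] (mod int N)"
      by (simp only: cong_add_lcancel)
    moreover have "snd (zs ! m) < N" "snd (zs ! k) < N" using cl lt k by auto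
    ultimately have "snd (zs ! m) = snd (zs ! k)" by (rule cong_less_imp_eq)
    moreover have "fst (zs ! m) = fst (zs ! k)" using xkm k lt n zs(1) by (metis nth_map)
    ultimately have "zs ! m = zs ! k" by (simp add: prod_eq_iff)
    then show False using km zs(2) k lt n by (metis nth_eq_iff_index_eq)
  qed
  then show ?thesis using cl by (simp add: tbc_walk_iff)
qed

text \<open>After one full turn the layer must be the initial one. This necessary condition is what
  bounds the lifting probability for walks that are not zero-permutation.\<close>

lemma cycle_lift_shift_sum:
  assumes G: "bipartite_graph U W E" and lift: "has_cycle_lift U W E N p xs"
  shows "[(\<Sum>s\<leftarrow>walk_steps xs. step_shift U p s) = 0] (mod int N)"
proof -
  obtain zs where zs: "map fst zs = xs" "closed_walk (cyclic_lift U W E N p) zs"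
    using lift by (auto simp: has_cycle_lift_def)
  have n: "length zs = length xs" using zs(1) by auto
  have "[int (snd (zs ! 0)) + 0 = int (snd (zs ! 0)) + (\<Sum>s\<leftarrow>walk_steps xs. step_shift U p s)] (mod int N)"
    using lift_snd_cong[OF G zs(2) order.refl] by (simp add: zs(1) n)
  then show ?thesis by (simp only: cong_add_lcancel cong_sym)
qed

text \<open>Rotate so that the subwalk comes first. Its total shift is zero for every choice of
  shifts, so the lift is back at its first vertex after \<open>k\<close> steps, before the walk has
  closed.\<close>

lemma no_cycle_lift_if_zp_subwalk:
  assumes G: "bipartite_graph U W E" and sub: "has_zp_tbc_subwalk E xs"
  shows "\<not> has_cycle_lift U W E N p xs"
proof
  assume lift: "has_cycle_lift U W E N p xs"
  obtain ys r k where ys: "tbc_walk E ys" "zero_perm ys" "k < length xs"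
      and steps: "walk_steps ys = take k (rotate r (walk_steps xs))"
    using sub by (auto simp: has_zp_tbc_subwalk_def tbc_subwalk_def)
  define xs' where "xs' = rotate r xs"
  have "has_cycle_lift U W E N p xs'"
    using has_cycle_lift_equiv[OF _ lift] by (auto simp: walk_equiv_def xs'_def)
  then obtain zs where zs: "map fst zs = xs'" "distinct zs" "closed_walk (cyclic_lift U W E N p) zs"
    by (auto simp: has_cycle_lift_def)
  have n: "length zs = length xs'" using zs(1) by auto
  have st: "walk_steps ys = take k (walk_steps xs')" using steps by (simp add: walk_steps_rotate xs'_def)
  have k: "k < length xs'" using ys(3) by (simp add: xs'_def)
  have lys: "length ys = k" using arg_cong[OF st, of length] k by simp
  have "ys \<noteq> []" using ys(1) by (auto simp: tbc_walk_def closed_walk_def)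
  then have k0: "0 < k" using lys by (metis length_greater_0_conv)
  \<comment> \<open>The last step of \<open>ys\<close> ends at its first vertex, while the same step
    of \<open>xs'\<close> ends at position \<open>k\<close>; hence \<open>xs'\<close> repeats its
    first vertex there.\<close>
  have "walk_steps ys ! (k - 1) = walk_steps xs' ! (k - 1)" "walk_steps ys ! 0 = walk_steps xs' ! 0"
    using st k0 by simp_all
  moreover have "walk_steps ys ! (k - 1) = (ys ! (k - 1), ys ! 0)"
    using nth_walk_steps[of "k - 1" ys] k0 lys by simp
  moreover have "walk_steps xs' ! (k - 1) = (xs' ! (k - 1), xs' ! k)"
    using nth_walk_steps[of "k - 1" xs'] k0 k by simp
  moreover have "fst (walk_steps ys ! 0) = ys ! 0" "fst (walk_steps xs' ! 0) = xs' ! 0"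
    using nth_walk_steps[of 0 ys] nth_walk_steps[of 0 xs'] k0 k lys by (metis fst_conv order.strict_trans)+
  ultimately have "xs' ! k = xs' ! 0" by simp
  moreover have "fst (zs ! l) = xs' ! l" if "l < length xs'" for l
    using that n zs(1) by (metis nth_map)
  ultimately have fst_eq: "fst (zs ! k) = fst (zs ! 0)"
    using k k0 order.strict_trans[OF k0 k] by presburger
  have "(\<Sum>s\<leftarrow>take k (walk_steps xs'). step_shift U p s) = 0"
    unfolding st[symmetric] using ys
    by (intro balanced_sum_shift[OF G]) (auto simp: zero_perm_iff_balanced tbc_walk_def dest: closed_walk_steps_in)
  then have "[int (snd (zs ! k)) = int (snd (zs ! 0))] (mod int N)"
    using lift_snd_cong[OF G zs(3), of k] k n zs(1) by simp
  moreover have "snd (zs ! k) < N" "snd (zs ! 0) < N"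
    using zs(3) k n order.strict_trans[OF k0 k] unfolding closed_walk_lift_iff[OF G] by simp_all
  ultimately have "snd (zs ! k) = snd (zs ! 0)" by (rule cong_less_imp_eq)
  then have "zs ! k = zs ! 0" using fst_eq by (simp add: prod_eq_iff)
  then show False using zs(2) k k0 n by (metis nth_eq_iff_index_eq order.strict_trans less_irrefl)
qed

text \<open>The two outer steps are reverses of each other, so they contribute equally to both
  counts being compared.\<close>

lemma balanced_Cons_snoc: "balanced ((a, b) # st @ [(b, a)]) \<longleftrightarrow> balanced st"
proof -
  have count: "count_list (s # st @ [t]) z = count_list st z + (of_bool (s = z) + of_bool (t = z))"
    for s t z :: "'a \<times> 'a"
    by simp
  have swap: "((b, a) = (y, x)) = ((a, b) = (x, y))" for x y
    by (simp only: prod.inject conj_commute)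
  have "(of_bool ((a, b) = (x, y)) :: nat) + of_bool ((b, a) = (x, y)) =
      of_bool ((a, b) = (y, x)) + of_bool ((b, a) = (y, x))" for x y
    unfolding swap by (rule add.commute)
  then have "count_list ((a, b) # st @ [(b, a)]) (x, y) = count_list ((a, b) # st @ [(b, a)]) (y, x)
      \<longleftrightarrow> count_list st (x, y) = count_list st (y, x)" for x y
    unfolding count by (simp only: add_right_cancel)
  then show ?thesis
    unfolding balanced_def by (simp only:)
qed

text \<open>A balanced closed segment may have a tail: its first and last step then cancel, and removing
  them leaves a shorter balanced closed segment.\<close>

lemma zp_subwalk_of_balanced_segment:
  assumes G: "bipartite_graph U W E" and tbc: "tbc_walk E xs"
    and "i < j" "j < length xs" "xs ! i = xs ! j"
    and "balanced (take (j - i) (drop i (walk_steps xs)))"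
  shows "has_zp_tbc_subwalk E xs"
  using assms(3-)
proof (induction "j - i" arbitrary: i j rule: less_induct)
  case less
  let ?n = "length xs" and ?st = "walk_steps xs"
  define ys where "ys = take (j - i) (drop i xs)"
  have lys: "length ys = j - i" using less.prems by (simp add: ys_def)
  have edge: "{xs ! k, xs ! Suc k} \<in> E" if "Suc k < ?n" for k
    using tbc that unfolding tbc_walk_def closed_walk_iff by (metis Suc_lessD mod_less)
  have no_back: "{xs ! k, xs ! Suc k} \<noteq> {xs ! Suc k, xs ! Suc (Suc k)}" if "Suc (Suc k) < ?n" for k
  proof -
    have "walk_edges xs ! k \<noteq> walk_edges xs ! Suc k" using tbc that by (simp add: tbc_walk_def)
    then show ?thesis using that by (simp add: nth_walk_edges)
  qed
  have step: "?st ! k = (xs ! k, xs ! Suc k)" if "Suc k < ?n" for k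
    using that by (simp add: nth_walk_steps)
  have steps: "walk_steps ys = take (j - i) (drop i ?st)"
  proof (rule nth_equalityI)
    fix k assume "k < length (walk_steps ys)"
    then have k: "k < j - i" using lys by simp
    have "ys ! (Suc k mod length ys) = xs ! Suc (i + k)"
    proof (cases "Suc k = j - i")
      case True
      then have "Suc (i + k) = j" using less.prems by simp
      then show ?thesis using True less.prems lys by (simp add: ys_def)
    next
      case False
      then show ?thesis using k lys less.prems by (simp add: ys_def)
    qed
    moreover have "ys ! k = xs ! (i + k)" using k less.prems by (simp add: ys_def)
    ultimately have "walk_steps ys ! k = (xs ! (i + k), xs ! Suc (i + k))"
      using k lys by (simp add: nth_walk_steps)
    then show "walk_steps ys ! k = take (j - i) (drop i ?st) ! k"
      using k less.prems by (simp add: step)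
  qed (use less.prems lys in simp)
  have zp: "zero_perm ys" using less.prems steps by (simp add: zero_perm_iff_balanced)
  have we: "walk_edges ys ! k = {xs ! (i + k), xs ! Suc (i + k)}" if "k < j - i" for k
    using that less.prems lys by (simp add: walk_edges_def steps step)
  have cl: "closed_walk E ys"
    unfolding closed_walk_def
  proof
    show "set (walk_edges ys) \<subseteq> E"
      using we less.prems lys edge by (auto simp: in_set_conv_nth)
  qed (use less.prems lys in auto)
  show ?case
  proof (cases "tbc_walk E ys")
    case True
    have "take (j - i) (rotate i ?st) = take (j - i) (drop i ?st)"
      using less.prems by (simp add: rotate_drop_take)
    then have "tbc_subwalk E ys xs"
      unfolding tbc_subwalk_def steps using True less.prems
      by (intro conjI exI[of _ i] exI[of _ "j - i"]) auto
    then show ?thesis using zp by (auto simp: has_zp_tbc_subwalk_def)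
  next
    case False
    then obtain k where k: "k < j - i" "walk_edges ys ! k = walk_edges ys ! (Suc k mod (j - i))"
      using cl lys by (auto simp: tbc_walk_iff)
    \<comment> \<open>Inside the segment, backtracking is excluded by \<open>xs\<close> itself. Only
      the closing condition can fail, so the first and last edges agree.\<close>
    have Suc_k: "Suc k = j - i"
    proof (rule ccontr)
      assume "Suc k \<noteq> j - i"
      then have "Suc k < j - i" using k by simp
      then show False using k we[of k] we[of "Suc k"] no_back[of "i + k"] less.prems by simp
    qed
    then have j: "j = Suc (i + k)" using less.prems by simp
    have "walk_edges ys ! k = walk_edges ys ! 0" using k(2) Suc_k by simp
    then have "{xs ! (i + k), xs ! j} = {xs ! i, xs ! Suc i}"
      using we[OF k(1)] we[of 0] k(1) by (simp flip: j)
    moreover have "xs ! i \<noteq> xs ! Suc i"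
      using edge_distinct[OF G edge[of i]] less.prems by simp
    ultimately have eq: "xs ! (i + k) = xs ! Suc i" using less.prems by (auto simp: doubleton_eq_iff)
    \<comment> \<open>What is left after cutting the tail must still be a proper segment:
      \<open>k = 0\<close> would give a loop, \<open>k = 1\<close> a backtracking of
      \<open>xs\<close>.\<close>
    have "k \<noteq> 0" using eq \<open>xs ! i \<noteq> xs ! Suc i\<close> by (metis add_0_right)
    moreover have "k \<noteq> 1"
      using no_back[of i] less.prems j by (auto simp: insert_commute)
    ultimately have k2: "2 \<le> k" by simp
    have "take (j - i) (drop i ?st) = ?st ! i # take (k - 1) (drop (Suc i) ?st) @ [?st ! (i + k)]"
    proof -
      have "drop i ?st = ?st ! i # drop (Suc i) ?st"
        using less.prems by (simp add: Cons_nth_drop_Suc)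
      moreover have "take k (drop (Suc i) ?st) = take (k - 1) (drop (Suc i) ?st) @ [?st ! (i + k)]"
        using take_Suc_conv_app_nth[of "k - 1" "drop (Suc i) ?st"] k2 j less.prems by simp
      ultimately show ?thesis by (simp add: j)
    qed
    moreover have "?st ! i = (xs ! i, xs ! Suc i)" "?st ! (i + k) = (xs ! Suc i, xs ! i)"
      using less.prems j eq by (simp_all add: step)
    ultimately have "balanced (take (k - 1) (drop (Suc i) ?st))"
      using less.prems by (simp add: balanced_Cons_snoc)
    then show ?thesis
      using less.hyps[of "i + k" "Suc i"] k2 j eq less.prems by simp
  qed
qed

text \<open>Start in layer 0 and use the partial sums modulo N as layers. If this lift repeats a
  vertex, the segment between the two visits has shift zero; were it balanced, the walk would
  contain a zero-permutation subwalk and not be prime.\<close>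

lemma prime_zp_no_cycle_lift:
  assumes G: "bipartite_graph U W E" and "prime_zp_tbc_walk E xs" "0 < N"
    and "\<not> has_cycle_lift U W E N p xs"
  obtains i j where "i < j" "j < length xs" "\<not> balanced (take (j - i) (drop i (walk_steps xs)))"
    "[(\<Sum>s\<leftarrow>take (j - i) (drop i (walk_steps xs)). step_shift U p s) = 0] (mod int N)"
proof -
  let ?n = "length xs" and ?st = "walk_steps xs"
  let ?h = "\<lambda>k. \<Sum>s\<leftarrow>take k ?st. step_shift U p s"
  define zs where "zs = map (\<lambda>k. (xs ! k, nat (?h k mod int N))) [0..<?n]"
  have tbc: "tbc_walk E xs" and zp: "zero_perm xs" and prime: "\<not> has_zp_tbc_subwalk E xs"
    using assms by (auto simp: prime_zp_tbc_walk_def zp_tbc_walk_def)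
  have cl: "closed_walk E xs" using tbc by (simp add: tbc_walk_def)
  then have ne: "xs \<noteq> []" by (simp add: closed_walk_def)
  have fst_zs: "map fst zs = xs" unfolding zs_def by (simp add: o_def map_nth)
  have snd_zs: "int (snd (zs ! k)) = ?h k mod int N" if "k < ?n" for k
    using that assms by (simp add: zs_def)
  \<comment> \<open>Since the walk is zero-permutation, the lift closes up whatever the shifts are;
    only distinctness of its vertices can fail.\<close>
  have sum0: "?h ?n = 0"
    using balanced_sum_shift[OF G closed_walk_steps_in[OF cl]] zp by (simp add: zero_perm_iff_balanced)
  have "closed_walk (cyclic_lift U W E N p) zs"
    unfolding closed_walk_lift_iff[OF G] fst_zs
  proof (intro conjI allI impI)
    fix k assume "k < length zs"
    then have k: "k < ?n" by (simp add: zs_def)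
    have l: "length zs = ?n" by (simp add: zs_def)
    show "snd (zs ! k) < N" using snd_zs[OF k] assms by (metis of_nat_0_less_iff of_nat_less_iff pos_mod_bound)
    have "?h k + step_shift U p (?st ! k) = ?h (Suc k)"
      using k by (simp add: take_Suc_conv_app_nth)
    moreover have "[?h (Suc k mod ?n) = ?h (Suc k)] (mod int N)"
      using k sum0 by (cases "Suc k = ?n") auto
    moreover have "Suc k mod ?n < ?n" using ne by simp
    moreover have "[?h k mod int N + step_shift U p (?st ! k) = ?h k + step_shift U p (?st ! k)] (mod int N)"
      by (intro cong_add) auto
    ultimately show "[int (snd (zs ! (Suc k mod length zs))) = int (snd (zs ! k)) + step_shift U p (?st ! k)] (mod int N)"
      using k by (simp add: l snd_zs cong_def)
  qed (rule cl)
  then have "\<not> distinct zs" using fst_zs assms by (auto simp: has_cycle_lift_def)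
  then obtain i j where ij: "i < j" "j < length zs" "zs ! i = zs ! j"
    unfolding distinct_conv_nth by (metis linorder_neqE_nat)
  have l: "length zs = ?n" by (simp add: zs_def)
  have x: "xs ! i = xs ! j" using ij l by (simp add: zs_def)
  have "?h i mod int N = ?h j mod int N" using ij l snd_zs[of i] snd_zs[of j] by simp
  moreover have "?h j = ?h i + (\<Sum>s\<leftarrow>take (j - i) (drop i ?st). step_shift U p s)"
    using ij take_add[of i "j - i" ?st] by simp
  ultimately have "[?h i + (\<Sum>s\<leftarrow>take (j - i) (drop i ?st). step_shift U p s) = ?h i + 0] (mod int N)"
    by (simp add: cong_def)
  then have "[(\<Sum>s\<leftarrow>take (j - i) (drop i ?st). step_shift U p s) = 0] (mod int N)"
    by (simp only: cong_add_lcancel)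
  with that show thesis
    using zp_subwalk_of_balanced_segment[OF G tbc ij(1) _ x] prime ij l by auto
qed

section \<open>The net flow of a closed walk as a circulation\<close>

lemma sum_count_list_fst:
  assumes "finite X" "snd ` set st \<subseteq> X"
  shows "(\<Sum>b\<in>X. count_list st (a, b)) = count_list (map fst st) a"
  using assms(2)
proof (induction st)
  case (Cons s st)
  have "(\<Sum>b\<in>X. count_list (s # st) (a, b)) =
      (\<Sum>b\<in>X. (if snd s = b then of_bool (fst s = a) else 0) + count_list st (a, b))"
    by (intro sum.cong) (auto simp: prod_eq_iff)
  also have "\<dots> = of_bool (fst s = a) + (\<Sum>b\<in>X. count_list st (a, b))"
    using Cons.prems assms(1) by (simp add: sum.distrib)
  finally show ?case using Cons by simp
qed simp

lemma sum_count_list_snd: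
  assumes "finite X" "fst ` set st \<subseteq> X"
  shows "(\<Sum>b\<in>X. count_list st (b, a)) = count_list (map snd st) a"
  using assms(2)
proof (induction st)
  case (Cons s st)
  have "(\<Sum>b\<in>X. count_list (s # st) (b, a)) =
      (\<Sum>b\<in>X. (if fst s = b then of_bool (snd s = a) else 0) + count_list st (b, a))"
    by (intro sum.cong) (auto simp: prod_eq_iff)
  also have "\<dots> = of_bool (snd s = a) + (\<Sum>b\<in>X. count_list st (b, a))"
    using Cons.prems assms(1) by (simp add: sum.distrib)
  finally show ?case using Cons by simp
qed simp

text \<open>A closed walk leaves each vertex as often as it enters it, so the net flows out of
  \<open>a\<close> sum to zero and one nonzero term requires another.\<close>

lemma flow_conservation:
  defines "d \<equiv> \<lambda>xs a b. int (count_list (walk_steps xs) (a, b)) - int (count_list (walk_steps xs) (b, a))"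
  assumes "d xs a b \<noteq> 0"
  obtains b' where "b' \<noteq> b" "d xs a b' \<noteq> 0"
proof -
  let ?st = "walk_steps xs"
  have steps: "map fst ?st = xs" "map snd ?st = rotate1 xs" by (simp_all add: walk_steps_def)
  have sub: "snd ` set ?st \<subseteq> set xs" "fst ` set ?st \<subseteq> set xs"
    using arg_cong[OF steps(1), of set] arg_cong[OF steps(2), of set] by auto
  have "(\<Sum>b\<in>set xs. count_list ?st (a, b)) = count_list xs a"
    using sum_count_list_fst[OF finite_set sub(1)] steps(1) by metis
  moreover have "(\<Sum>b\<in>set xs. count_list ?st (b, a)) = count_list (rotate1 xs) a"
    using sum_count_list_snd[OF finite_set sub(2)] steps(2) by metis
  moreover have "count_list (rotate1 xs) a = count_list xs a"
    by (cases xs) auto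
  ultimately have sum0: "(\<Sum>b\<in>set xs. d xs a b) = 0"
    by (simp add: d_def sum_subtractf flip: of_nat_sum)
  have "b \<in> set xs"
  proof (rule ccontr)
    assume "b \<notin> set xs"
    then have "(a, b) \<notin> set ?st" "(b, a) \<notin> set ?st"
      using sub by force+
    then have "d xs a b = 0" by (simp add: d_def count_list_0_iff)
    then show False using assms by simp
  qed
  then have "d xs a b + (\<Sum>b'\<in>set xs - {b}. d xs a b') = 0"
    using sum0 by (simp add: sum.remove)
  then have "(\<Sum>b'\<in>set xs - {b}. d xs a b') \<noteq> 0" using assms by linarith
  then obtain b' where "b' \<in> set xs - {b}" "d xs a b' \<noteq> 0" by (rule sum.not_neutral_contains_not_neutral)
  then show thesis using that by blast
qed

lemma sum_list_count_le_length:
  assumes "distinct ps"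
  shows "(\<Sum>p\<leftarrow>ps. count_list st p) \<le> length st"
proof -
  have "(\<Sum>p\<leftarrow>ps. count_list st p) = sum (count_list st) (set ps)"
    using assms by (simp add: sum_list_distinct_conv_sum_set)
  also have "\<dots> \<le> sum (count_list st) (set ps \<union> set st)"
    by (intro sum_mono2) auto
  also have "\<dots> = length st" by (intro sum_count_set) auto
  finally show ?thesis .
qed

text \<open>The net flow of a closed walk is a circulation, so no vertex meets its support in exactly one
  edge.  If it is not zero, its support contains a path \<open>u2, w, u, w2, u3\<close> (a 4-cycle if
  \<open>u2 = u3\<close>), and one of these four edges carries at most a quarter of the walk.\<close>

lemma exists_small_net_flow:
  assumes G: "bipartite_graph U W E" and cl: "closed_walk E xs" and nb: "\<not> zero_perm xs"
  obtains e where "e \<in> E" "net_flow U (walk_steps xs) e \<noteq> 0"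
    "4 * \<bar>net_flow U (walk_steps xs) e\<bar> \<le> int (length xs)"
proof -
  note witness = that
  let ?st = "walk_steps xs"
  let ?c = "count_list ?st"
  let ?d = "\<lambda>a b. int (?c (a, b)) - int (?c (b, a))"
  have edge: "{a, b} \<in> E" if "?d a b \<noteq> 0" for a b
  proof -
    have "(a, b) \<in> set ?st \<or> (b, a) \<in> set ?st"
    proof (rule ccontr)
      assume "\<not> ?thesis"
      then have "?c (a, b) = 0" "?c (b, a) = 0" by (simp_all add: count_list_0_iff)
      then show False using that by simp
    qed
    then show ?thesis using closed_walk_steps_in[OF cl] by (auto simp: insert_commute)
  qed
  have sym: "?d b a \<noteq> 0" if "?d a b \<noteq> 0" for a b using that by linarith
  have disj: "a \<notin> U" if "a \<in> W" for a using G that by (auto simp: bipartite_graph_def)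
  have U_side: "b \<in> W" if "{a, b} \<in> E" "a \<in> U" for a b
    by (rule edgeE[OF G that(1)]) (use that(2) in \<open>auto simp: doubleton_eq_iff\<close>)
  have W_side: "b \<in> U" if "{a, b} \<in> E" "a \<in> W" for a b
    by (rule edgeE[OF G that(1)]) (use disj[OF that(2)] in \<open>auto simp: doubleton_eq_iff\<close>)
  obtain a b where "?d a b \<noteq> 0"
    using nb by (auto simp: zero_perm_def)
  moreover obtain u' w' where "{a, b} = {u', w'}" "u' \<in> U"
    by (rule edgeE[OF G edge[OF calculation]])
  ultimately obtain u w where d1: "?d u w \<noteq> 0" and u: "u \<in> U"
    using sym by (metis doubleton_eq_iff)
  obtain w2 where w2: "w2 \<noteq> w" and d2: "?d u w2 \<noteq> 0" by (rule flow_conservation[OF d1])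
  obtain u2 where u2: "u2 \<noteq> u" and d3: "?d w u2 \<noteq> 0" by (rule flow_conservation[OF sym[OF d1]])
  obtain u3 where u3: "u3 \<noteq> u" and d4: "?d w2 u3 \<noteq> 0" by (rule flow_conservation[OF sym[OF d2]])
  have W: "w \<in> W" "w2 \<in> W" using U_side u edge d1 d2 by blast+
  have U: "u2 \<in> U" "u3 \<in> U" using W_side W edge d3 d4 by blast+
  have ne: "x \<noteq> y" "y \<noteq> x" if "x \<in> U" "y \<in> W" for x y using disj that by auto
  \<comment> \<open>Both directions of the four edges of the path. They stay distinct when
    \<open>u2 = u3\<close>, because \<open>w2\<close> differs from \<open>w\<close>.\<close>
  have "distinct [(u, w), (w, u), (u, w2), (w2, u), (u2, w), (w, u2), (u3, w2), (w2, u3)]"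
    using w2 u2 u3 ne[OF u W(1)] ne[OF u W(2)] ne[OF U(1) W(1)] ne[OF U(1) W(2)]
      ne[OF U(2) W(1)] ne[OF U(2) W(2)] by simp
  from sum_list_count_le_length[OF this, of ?st]
  have "?c (u, w) + ?c (w, u) + (?c (u, w2) + ?c (w2, u)) + (?c (u2, w) + ?c (w, u2))
      + (?c (u3, w2) + ?c (w2, u3)) \<le> length xs" by simp
  then have "\<bar>?d u w\<bar> + \<bar>?d u w2\<bar> + \<bar>?d u2 w\<bar> + \<bar>?d u3 w2\<bar> \<le> int (length xs)" by linarith
  moreover have "4 * i \<le> n \<or> 4 * j \<le> n \<or> 4 * k \<le> n \<or> 4 * l \<le> n"
    if "i + j + k + l \<le> n" for i j k l n :: int
    using that by linarith
  ultimately have small: "4 * \<bar>?d u w\<bar> \<le> int (length xs) \<or> 4 * \<bar>?d u w2\<bar> \<le> int (length xs) \<or>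
      4 * \<bar>?d u2 w\<bar> \<le> int (length xs) \<or> 4 * \<bar>?d u3 w2\<bar> \<le> int (length xs)" by blast
  have thesis if s: "4 * \<bar>?d x y\<bar> \<le> int (length xs)" and nz: "?d x y \<noteq> 0"
    and xy: "x \<in> U" "y \<in> W" for x y
    using s nz
    by (intro witness[of "{x, y}"] edge[OF nz]) (simp_all add: net_flow_eq[OF xy(1) disj[OF xy(2)]])
  from this[OF _ d1 u W(1)] this[OF _ d2 u W(2)] this[OF _ sym[OF d3] U(1) W(1)]
    this[OF _ sym[OF d4] U(2) W(2)]
  show thesis using small by blast
qed

section \<open>Counting the lifts of a closed walk\<close>

lemma set_closed_walk:
  assumes "bipartite_graph U W E" "closed_walk E xs"
  shows "set xs \<subseteq> U \<union> W"
proof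
  fix x assume "x \<in> set xs"
  then obtain k where "k < length xs" "x = xs ! k" by (auto simp: in_set_conv_nth)
  then have "{x, xs ! (Suc k mod length xs)} \<in> E" using assms(2) by (auto simp: closed_walk_iff)
  then show "x \<in> U \<union> W" by (rule edgeE[OF assms(1)]) (auto simp: doubleton_eq_iff)
qed

lemma finite_closed_walks:
  assumes "bipartite_graph U W E"
  shows "finite {xs. length xs = c \<and> closed_walk E xs}"
proof (rule finite_subset)
  show "{xs. length xs = c \<and> closed_walk E xs} \<subseteq> {xs. set xs \<subseteq> U \<union> W \<and> length xs = c}"
    using set_closed_walk[OF assms] by auto
  show "finite {xs. set xs \<subseteq> U \<union> W \<and> length xs = c}"
    using assms by (intro finite_lists_length_eq) (simp add: bipartite_graph_def)
qed

lemma closed_walk_lift_unique: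
  assumes G: "bipartite_graph U W E"
    and zs: "closed_walk (cyclic_lift U W E N p) zs" "closed_walk (cyclic_lift U W E N p) zs'"
    and eq: "map fst zs = map fst zs'" "snd (zs ! 0) = snd (zs' ! 0)"
  shows "zs = zs'"
proof (rule nth_equalityI)
  show len: "length zs = length zs'" using arg_cong[OF eq(1), of length] by simp
  fix k assume k: "k < length zs"
  then have k': "k < length zs'" using len by simp
  have "[int (snd (zs ! k)) = int (snd (zs' ! 0)) +
          (\<Sum>s\<leftarrow>take k (walk_steps (map fst zs')). step_shift U p s)] (mod int N)"
    using lift_snd_cong[OF G zs(1), of k] k eq by simp
  moreover have "[int (snd (zs' ! k)) = int (snd (zs' ! 0)) +
          (\<Sum>s\<leftarrow>take k (walk_steps (map fst zs')). step_shift U p s)] (mod int N)"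
    using lift_snd_cong[OF G zs(2), of k] k' by simp
  ultimately have "[int (snd (zs ! k)) = int (snd (zs' ! k))] (mod int N)"
    by (simp add: cong_def)
  moreover have "snd (zs ! k) < N" "snd (zs' ! k) < N"
    using zs k k' unfolding closed_walk_lift_iff[OF G] by blast+
  ultimately have "snd (zs ! k) = snd (zs' ! k)" by (rule cong_less_imp_eq)
  moreover have "fst (zs ! k) = fst (zs' ! k)" using eq(1) k k' by (metis nth_map)
  ultimately show "zs ! k = zs' ! k" by (simp add: prod_eq_iff)
qed

text \<open>Adding a constant to all layers is a symmetry of the lift, since adjacency depends only
  on differences of layers.\<close>

lemma closed_walk_lift_translate:
  assumes G: "bipartite_graph U W E" and "0 < N"
    and zs: "closed_walk (cyclic_lift U W E N p) zs"
  shows "closed_walk (cyclic_lift U W E N p) (map (\<lambda>(v, i). (v, (i + d) mod N)) zs)"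
proof -
  let ?zs = "map (\<lambda>(v, i). (v, (i + d) mod N)) zs"
  have fst_eq: "map fst ?zs = map fst zs" by (simp add: case_prod_beta o_def)
  have snd_eq: "snd (?zs ! k) = (snd (zs ! k) + d) mod N" if "k < length zs" for k
    using that by (simp add: case_prod_beta)
  show ?thesis
    unfolding closed_walk_lift_iff[OF G] fst_eq
  proof (intro conjI allI impI)
    show "closed_walk E (map fst zs)" using zs closed_walk_lift_iff[OF G] by blast
    fix k assume "k < length ?zs"
    then have k: "k < length zs" by simp
    then show "snd (?zs ! k) < N" using snd_eq assms(2) by simp
    have l: "Suc k mod length zs < length zs" using k by (intro mod_less_divisor) linarith
    have "[int (snd (zs ! (Suc k mod length zs))) + int d =
       int (snd (zs ! k)) + step_shift U p (walk_steps (map fst zs) ! k) + int d] (mod int N)"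
      using zs k unfolding closed_walk_lift_iff[OF G] by (intro cong_add) auto
    moreover have "[(int (snd (zs ! k)) + int d) mod int N + step_shift U p (walk_steps (map fst zs) ! k) =
        (int (snd (zs ! k)) + int d) + step_shift U p (walk_steps (map fst zs) ! k)] (mod int N)"
      by (intro cong_add) auto
    ultimately show "[int (snd (?zs ! (Suc k mod length ?zs))) =
          int (snd (?zs ! k)) + step_shift U p (walk_steps (map fst zs) ! k)] (mod int N)"
      unfolding length_map snd_eq[OF k] snd_eq[OF l] of_nat_mod of_nat_add
      by (simp add: cong_def add_ac)
  qed
qed

text \<open>A list running around a cycle of the lift is determined by its projection and its
  starting layer; by translation every starting layer occurs.\<close>

lemma card_cycles_cyclic_lift:
  assumes G: "bipartite_graph U W E" and N: "0 < N" and c: "3 \<le> c"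
  shows "2 * c * card (cycles (cyclic_lift U W E N p) c)
           = N * card {xs. length xs = c \<and> has_cycle_lift U W E N p xs}"
proof -
  let ?H = "cyclic_lift U W E N p"
  let ?L = "{zs. length zs = c \<and> distinct zs \<and> closed_walk ?H zs}"
  let ?X = "{xs. length xs = c \<and> has_cycle_lift U W E N p xs}"
  let ?f = "\<lambda>zs. (map fst zs, snd (zs ! 0))"
  have inj: "inj_on ?f ?L"
    by (rule inj_onI) (auto intro: closed_walk_lift_unique[OF G])
  have img: "?f ` ?L = ?X \<times> {..<N}"
  proof
    show "?f ` ?L \<subseteq> ?X \<times> {..<N}"
      using c unfolding closed_walk_lift_iff[OF G] has_cycle_lift_def by force
    show "?X \<times> {..<N} \<subseteq> ?f ` ?L"
    proof
      fix q assume "q \<in> ?X \<times> {..<N}"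
      then obtain i zs where q: "q = (map fst zs, i)" "i < N" "length zs = c" "distinct zs"
          "closed_walk ?H zs"
        by (auto simp: has_cycle_lift_def)
      \<comment> \<open>The translation that moves the starting layer to \<open>i\<close>; adding N
        before subtracting keeps the arithmetic within the naturals.\<close>
      let ?h = "\<lambda>(v, j). (v, (j + (i + (N - snd (zs ! 0)))) mod N)"
      have lt: "snd (zs ! k) < N" if "k < c" for k
        using q that unfolding closed_walk_lift_iff[OF G] by blast
      have "inj_on ?h (set zs)"
      proof (rule inj_onI)
        fix x y assume xy: "x \<in> set zs" "y \<in> set zs" "?h x = ?h y"
        then have "snd x < N" "snd y < N" using lt q(3) by (auto simp: in_set_conv_nth)
        moreover have "fst x = fst y"
          "[snd x + (i + (N - snd (zs ! 0))) = snd y + (i + (N - snd (zs ! 0)))] (mod N)"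
          using xy(3) by (auto simp: case_prod_beta cong_def)
        ultimately show "x = y"
          by (simp only: cong_add_rcancel_nat) (simp add: cong_def prod_eq_iff)
      qed
      then have "map ?h zs \<in> ?L"
        using q closed_walk_lift_translate[OF G N] by (simp add: distinct_map)
      moreover have "?f (map ?h zs) = q"
      proof -
        have "0 < length zs" using q(3) c by linarith
        then have "snd (map ?h zs ! 0) = (snd (zs ! 0) + (i + (N - snd (zs ! 0)))) mod N"
          by (simp add: case_prod_beta)
        also have "\<dots> = i" using lt[of 0] c q(2) by simp
        finally show ?thesis using q(1) by (simp add: case_prod_beta o_def)
      qed
      ultimately show "q \<in> ?f ` ?L" by blast
    qed
  qed
  have "?X \<subseteq> {xs. length xs = c \<and> closed_walk E xs}"
    unfolding has_cycle_lift_def closed_walk_lift_iff[OF G] by blast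
  then have "finite ?X" using finite_closed_walks[OF G] finite_subset by blast
  then have "finite (?f ` ?L)" unfolding img by simp
  then have "finite ?L" using inj by (rule finite_imageD)
  then have "2 * c * card (cycles ?H c) = card ?L" using c by (rule card_cycles)
  also have "\<dots> = card (?X \<times> {..<N})" using card_image[OF inj] img by simp
  finally show ?thesis by (simp add: card_cartesian_product mult.commute)
qed

subsection \<open>Probability and variance bounds\<close>

text \<open>For positive \<open>a\<close>, all solutions share the remainder of a * x modulo N. Each
  is thus fixed by its quotient, which takes at most \<open>a\<close> values. A negative
  \<open>a\<close> reduces to this by changing signs.\<close>

lemma card_linear_congruence_le:
  fixes a r :: int
  assumes "a \<noteq> 0" "0 < N"
  shows "card {x. x < N \<and> [a * int x = r] (mod int N)} \<le> nat \<bar>a\<bar>"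
proof -
  have pos: "card {x. x < N \<and> [a * int x = r] (mod int N)} \<le> nat a" if "0 < a" for a r :: int
  proof -
    let ?S = "{x. x < N \<and> [a * int x = r] (mod int N)}" and ?f = "\<lambda>x. a * int x div int N"
    have "inj_on ?f ?S"
    proof (rule inj_onI)
      fix x y assume "x \<in> ?S" "y \<in> ?S" "?f x = ?f y"
      then have "a * int x mod int N = a * int y mod int N" "?f x = ?f y"
        by (auto simp: cong_def)
      then have "a * int x = a * int y" by (metis div_mult_mod_eq)
      then show "x = y" using that by simp
    qed
    moreover have "?f ` ?S \<subseteq> {0..<a}"
    proof clarsimp
      fix x assume "x < N"
      then have "a * int x < a * int N" using that by simp
      moreover have "a * int x div int N * int N \<le> a * int x"
        using assms(2) by (simp flip: minus_mod_eq_div_mult)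
      ultimately have "a * int x div int N * int N < a * int N" by linarith
      then have "a * int x div int N < a" using assms(2) by simp
      then show "0 \<le> a * int x div int N \<and> a * int x div int N < a"
        using that by (simp add: pos_imp_zdiv_nonneg_iff assms)
    qed
    ultimately have "card ?S \<le> card {0..<a}" by (meson card_inj_on_le finite_atLeastLessThan_int)
    then show ?thesis by simp
  qed
  show ?thesis
  proof (cases "0 < a")
    case False
    have "[a * int x = r] (mod int N) \<longleftrightarrow> [(- a) * int x = - r] (mod int N)" for x
      using cong_minus_minus_iff[of "a * int x" r "int N"] by simp
    then show ?thesis using pos[of "- a" "- r"] False assms by simp
  qed (use pos in simp)
qed

text \<open>Condition on all shifts except that of \<open>e\<close>: whatever they are, at most |a
  e| of the N equally likely values of the last one satisfy the congruence.\<close>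

lemma prob_linear_congruence_le:
  fixes a :: "'a set \<Rightarrow> int"
  assumes "finite E" "e \<in> E" "a e \<noteq> 0" "0 < N"
  shows "measure_pmf.prob (random_shifts E N) {p. [(\<Sum>e\<in>E. a e * int (p e)) = 0] (mod int N)}
           \<le> real_of_int \<bar>a e\<bar> / real N"
proof -
  let ?X = "{p. [(\<Sum>e\<in>E. a e * int (p e)) = 0] (mod int N)}"
  let ?b = "real_of_int \<bar>a e\<bar> / real N"
  let ?E = "E - {e}"
  let ?q = "pmf_of_set {..<N}"
  have E: "insert e ?E = E" using assms by auto
  have ne: "{..<N} \<noteq> {}" using assms by auto
  have eq: "random_shifts E N =
      bind_pmf (Pi_pmf ?E 0 (\<lambda>_. ?q)) (\<lambda>f. map_pmf (\<lambda>y. f(e := y)) ?q)"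
    using Pi_pmf_insert'[of ?E e 0 "\<lambda>_. ?q"] assms
    unfolding random_shifts_def E map_pmf_def by (subst bind_commute_pmf) simp
  have "emeasure (map_pmf (\<lambda>y. f(e := y)) ?q) ?X \<le> ennreal ?b" for f
  proof -
    have "(\<Sum>e'\<in>E. a e' * int ((f(e := y)) e')) = a e * int y + (\<Sum>e'\<in>?E. a e' * int (f e'))" for y
      using assms by (subst sum.remove[of _ e]) (auto intro!: sum.cong)
    then have "{..<N} \<inter> {y. f(e := y) \<in> ?X} =
        {y. y < N \<and> [a e * int y = - (\<Sum>e'\<in>?E. a e' * int (f e'))] (mod int N)}"
      by (auto simp: cong_iff_dvd_diff)
    then have "measure_pmf.prob (map_pmf (\<lambda>y. f(e := y)) ?q) ?X \<le> ?b"
      using card_linear_congruence_le[OF assms(3,4)] ne assms(4)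
      by (simp add: measure_map_pmf vimage_def measure_pmf_of_set divide_right_mono le_nat_iff
          flip: of_nat_le_iff[where ?'a = real])
    then show ?thesis by (simp add: measure_pmf.emeasure_eq_measure ennreal_leI)
  qed
  then have "emeasure (random_shifts E N) ?X \<le> (\<integral>\<^sup>+f. ennreal ?b \<partial>Pi_pmf ?E 0 (\<lambda>_. ?q))"
    unfolding eq emeasure_bind_pmf by (intro nn_integral_mono)
  also have "\<dots> = ennreal ?b" by simp
  finally show ?thesis by (simp add: measure_pmf.emeasure_eq_measure)
qed

lemma finite_set_random_shifts:
  assumes "finite E" "0 < N"
  shows "finite (set_pmf (random_shifts E N))"
proof -
  have "{..<N} \<noteq> {}" using assms by auto
  then show ?thesis
    using assms by (auto simp: random_shifts_def set_Pi_pmf intro!: finite_PiE_dflt)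
qed

text \<open>The mean minimises the expected squared deviation. Taking \<open>k\<close> as the
  deterministic part of the cycle count avoids computing the mean.\<close>

lemma variance_pmf_le:
  fixes X :: "'b \<Rightarrow> real"
  assumes "finite (set_pmf M)"
  shows "measure_pmf.variance M X \<le> measure_pmf.expectation M (\<lambda>p. (X p - k)\<^sup>2)"
proof -
  have int: "integrable M f" for f :: "'b \<Rightarrow> real"
    using assms by (rule integrable_measure_pmf_finite)
  have "measure_pmf.expectation M (\<lambda>p. X p - k) = measure_pmf.expectation M X - k"
    by (simp add: int)
  then have "measure_pmf.variance M X = measure_pmf.variance M (\<lambda>p. X p - k)"
    by simp
  also have "\<dots> \<le> measure_pmf.expectation M (\<lambda>p. (X p - k)\<^sup>2)"
    by (subst measure_pmf.variance_eq) (simp_all add: int)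
  finally show ?thesis .
qed

text \<open>The sum S is at most |A|, hence S^2 is at most |A| times S. Only probabilities of single
  events enter, however the events depend on each other.\<close>

lemma expectation_square_sum_indicator_le:
  fixes M :: "'b pmf"
  assumes "finite (set_pmf M)" "finite A"
    and "\<And>x. x \<in> A \<Longrightarrow> measure_pmf.prob M (Q x) \<le> b"
  shows "measure_pmf.expectation M (\<lambda>p. (\<Sum>x\<in>A. indicat_real (Q x) p)\<^sup>2) \<le> (real (card A))\<^sup>2 * b"
proof -
  have int: "integrable M f" for f :: "'b \<Rightarrow> real"
    using assms by (intro integrable_measure_pmf_finite)
  let ?S = "\<lambda>p. \<Sum>x\<in>A. indicat_real (Q x) p"
  have "?S p \<le> (\<Sum>x\<in>A. 1)" for p by (intro sum_mono) (simp add: indicator_def)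
  then have "(?S p)\<^sup>2 \<le> real (card A) * ?S p" for p
    unfolding power2_eq_square by (intro mult_right_mono sum_nonneg) auto
  then have "measure_pmf.expectation M (\<lambda>p. (?S p)\<^sup>2) \<le> measure_pmf.expectation M (\<lambda>p. real (card A) * ?S p)"
    by (intro integral_mono int)
  also have "\<dots> = real (card A) * (\<Sum>x\<in>A. measure_pmf.prob M (Q x))"
    by (simp add: int)
  also have "\<dots> \<le> real (card A) * (\<Sum>x\<in>A. b)"
    using assms(3) by (intro mult_left_mono sum_mono) auto
  finally show ?thesis by (simp add: power2_eq_square algebra_simps)
qed

lemma prob_shift_sum_le:
  assumes G: "bipartite_graph U W E" and "0 < N" and st: "\<forall>s \<in> set st. {fst s, snd s} \<in> E"
    and "e \<in> E" "net_flow U st e \<noteq> 0"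
  shows "measure_pmf.prob (random_shifts E N) {p. [(\<Sum>s\<leftarrow>st. step_shift U p s) = 0] (mod int N)}
           \<le> real_of_int \<bar>net_flow U st e\<bar> / real N"
  unfolding sum_shift_eq[OF finite_edges[OF G] st]
  using finite_edges[OF G] assms by (intro prob_linear_congruence_le)

lemma prob_cycle_lift_le:
  assumes G: "bipartite_graph U W E" and N: "0 < N" and cl: "closed_walk E xs" and "\<not> zero_perm xs"
  shows "measure_pmf.prob (random_shifts E N) {p. has_cycle_lift U W E N p xs}
           \<le> real (length xs) / 4 / real N"
proof -
  obtain e where e: "e \<in> E" "net_flow U (walk_steps xs) e \<noteq> 0"
    "4 * \<bar>net_flow U (walk_steps xs) e\<bar> \<le> int (length xs)"
    by (rule exists_small_net_flow[OF G cl assms(4)])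
  have "measure_pmf.prob (random_shifts E N) {p. has_cycle_lift U W E N p xs} \<le>
     measure_pmf.prob (random_shifts E N) {p. [(\<Sum>s\<leftarrow>walk_steps xs. step_shift U p s) = 0] (mod int N)}"
    using cycle_lift_shift_sum[OF G] by (intro measure_pmf.finite_measure_mono) auto
  also have "\<dots> \<le> real_of_int \<bar>net_flow U (walk_steps xs) e\<bar> / real N"
    by (rule prob_shift_sum_le[OF G N closed_walk_steps_in[OF cl] e(1,2)])
  also have "\<dots> \<le> real (length xs) / 4 / real N"
    using e(3) by (intro divide_right_mono) linarith+
  finally show ?thesis .
qed

text \<open>A union bound over the index pairs i < j with unbalanced segment: there are at most n^2
  / 2 of them, and each contributes at most n / N because a net flow cannot exceed the length
  n.\<close>

lemma prob_no_cycle_lift_le: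
  assumes G: "bipartite_graph U W E" and N: "0 < N" and prime: "prime_zp_tbc_walk E xs"
  shows "measure_pmf.prob (random_shifts E N) {p. \<not> has_cycle_lift U W E N p xs}
           \<le> real (length xs) ^ 3 / 2 / real N"
proof -
  let ?n = "length xs" and ?M = "random_shifts E N"
  let ?seg = "\<lambda>(i, j). take (j - i) (drop i (walk_steps xs))"
  let ?Z = "\<lambda>q. {p. [(\<Sum>s\<leftarrow>?seg q. step_shift U p s) = 0] (mod int N)}"
  define J where "J = {(i, j). i < j \<and> j < ?n}"
  define I where "I = {q \<in> J. \<not> balanced (?seg q)}"
  have J: "J = prod.swap ` (SIGMA j:{..<?n}. {..<j})" by (auto simp: J_def image_iff)
  have "finite J" unfolding J by simp
  then have I: "finite I" "card I \<le> card J" by (auto simp: I_def intro: card_mono)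
  have "card J = (\<Sum>j<?n. j)" unfolding J by (simp add: card_image)
  moreover have "2 * (\<Sum>j<n. j) \<le> n * n" for n :: nat by (induction n) auto
  ultimately have "2 * card J \<le> ?n * ?n" by simp
  then have card_I: "2 * real (card I) \<le> real ?n * real ?n"
    using I(2) by (metis (mono_tags, lifting) le_trans mult_le_mono2 of_nat_le_iff of_nat_mult of_nat_numeral)
  have cl: "closed_walk E xs" using prime by (simp add: prime_zp_tbc_walk_def zp_tbc_walk_def tbc_walk_def)
  have "{p. \<not> has_cycle_lift U W E N p xs} \<subseteq> (\<Union>q\<in>I. ?Z q)"
  proof
    fix p assume "p \<in> {p. \<not> has_cycle_lift U W E N p xs}"
    then have no_lift: "\<not> has_cycle_lift U W E N p xs" by simp
    obtain i j where "i < j" "j < ?n" "\<not> balanced (?seg (i, j))"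
      "[(\<Sum>s\<leftarrow>?seg (i, j). step_shift U p s) = 0] (mod int N)"
      by (rule prime_zp_no_cycle_lift[OF G prime N no_lift]) simp
    then show "p \<in> (\<Union>q\<in>I. ?Z q)"
      by (intro UN_I[of "(i, j)"]) (simp_all add: I_def J_def)
  qed
  then have "measure_pmf.prob ?M {p. \<not> has_cycle_lift U W E N p xs} \<le> measure_pmf.prob ?M (\<Union>q\<in>I. ?Z q)"
    by (intro measure_pmf.finite_measure_mono) auto
  also have "\<dots> \<le> (\<Sum>q\<in>I. measure_pmf.prob ?M (?Z q))"
    using I by (intro measure_pmf.finite_measure_subadditive_finite) auto
  also have "\<dots> \<le> (\<Sum>q\<in>I. real ?n / real N)"
  proof (rule sum_mono)
    fix q assume q: "q \<in> I"
    have "set (?seg q) \<subseteq> set (walk_steps xs)"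
      by (auto simp: case_prod_beta dest: in_set_takeD in_set_dropD)
    then have edges: "\<forall>s \<in> set (?seg q). {fst s, snd s} \<in> E"
      using closed_walk_steps_in[OF cl] by blast
    obtain e where e: "e \<in> E" "net_flow U (?seg q) e \<noteq> 0"
      using q balanced_iff_net_flow[OF G edges] unfolding I_def by blast
    have "length (?seg q) \<le> ?n" by (simp add: case_prod_beta)
    then have "\<bar>net_flow U (?seg q) e\<bar> \<le> int ?n"
      using abs_net_flow_le[of U "?seg q" e] by linarith
    then have "real_of_int \<bar>net_flow U (?seg q) e\<bar> / real N \<le> real ?n / real N"
      by (intro divide_right_mono) linarith+
    with prob_shift_sum_le[OF G N edges e]
    show "measure_pmf.prob ?M (?Z q) \<le> real ?n / real N" by linarith
  qed
  also have "\<dots> = real (card I) * real ?n / real N" by simp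
  also have "\<dots> \<le> real ?n ^ 3 / 2 / real N"
  proof (rule divide_right_mono)
    have "real (card I) * real ?n \<le> real ?n * real ?n / 2 * real ?n"
      using card_I by (intro mult_right_mono) auto
    then show "real (card I) * real ?n \<le> real ?n ^ 3 / 2" by (simp add: power3_eq_cube)
  qed simp
  finally show ?thesis .
qed

section \<open>From lists to classes, and the variance bound\<close>

text \<open>Walks may repeat vertices and be symmetric, so classes can have fewer than 2c members;
  the upper bound suffices here.\<close>

lemma card_le_walk_classes:
  assumes "0 < c" "finite T" "\<And>xs. xs \<in> A \<Longrightarrow> length xs = c \<and> walk_equiv `` {xs} \<in> T"
  shows "card A \<le> 2 * c * card T"
proof -
  let ?T = "(\<lambda>xs. walk_equiv `` {xs}) ` A"
  have sub: "?T \<subseteq> T" using assms(3) by blast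
  then have fin: "finite ?T" using assms(2) by (rule finite_subset)
  have ne: "xs \<noteq> []" if "xs \<in> A" for xs using assms(1) assms(3)[OF that] by auto
  have "A \<subseteq> \<Union> ?T" using equiv_class_self[OF equiv_walk_equiv] by blast
  moreover have "finite (\<Union> ?T)" using fin ne by (auto simp: finite_walk_class)
  ultimately have "card A \<le> card (\<Union> ?T)" by (rule card_mono[rotated])
  also have "\<dots> \<le> (\<Sum>C\<in>?T. card C)"
    using card_UN_le[OF fin, of id] by simp
  also have "\<dots> \<le> (\<Sum>C\<in>?T. 2 * c)"
  proof (rule sum_mono)
    fix C assume "C \<in> ?T"
    then obtain xs where "xs \<in> A" "C = walk_equiv `` {xs}" by blast
    then show "card C \<le> 2 * c" using card_walk_class_le[OF ne] assms(3) by metis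
  qed
  also have "\<dots> \<le> 2 * c * card T" using card_mono[OF assms(2) sub] by simp
  finally show ?thesis .
qed

lemma has_cycle_lift_class_eq:
  assumes "walk_equiv `` {xs} = walk_equiv `` {ys}"
  shows "has_cycle_lift U W E N p xs \<longleftrightarrow> has_cycle_lift U W E N p ys"
proof -
  have "(xs, ys) \<in> walk_equiv" "(ys, xs) \<in> walk_equiv"
    using assms equiv_class_self[OF equiv_walk_equiv] by blast+
  then show ?thesis using has_cycle_lift_equiv by blast
qed

theorem theorem8:
  fixes U W :: "'a set" and E :: "'a set set" and c :: nat
  assumes "bipartite_graph U W E" and "even c" and "4 \<le> c"
  defines "T1 \<equiv> real (card (T1_set E c))"
    and "T3 \<equiv> real (card (T3_set E c))"
  shows "\<exists>K. \<forall>\<^sub>F N in sequentially.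
           measure_pmf.variance (random_shifts E N)
             (\<lambda>p. real (card (cycles (cyclic_lift U W E N p) c)))
           \<le> (real c ^ 3 / 2 * T1\<^sup>2 + real c / 4 * T3\<^sup>2 + real c / 2 * T1 * T3) * real N + K"
proof -
  note G = assms(1)
  let ?cls = "\<lambda>xs. walk_equiv `` {xs}"
  define S where "S = {xs. length xs = c \<and> tbc_walk E xs}"
  \<comment> \<open>Membership is tested on classes, because \<open>T3_set\<close> is a difference
    of sets of classes.\<close>
  define A1 where "A1 = {xs \<in> S. ?cls xs \<in> T1_set E c}"
  define A3 where "A3 = {xs \<in> S. ?cls xs \<in> T3_set E c}"
  have c: "0 < c" "3 \<le> c" using assms(3) by auto
  have finS: "finite S"
    by (rule finite_subset[OF _ finite_closed_walks[OF G, of c]]) (auto simp: S_def tbc_walk_def)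
  have fin: "finite A1" "finite A3" and disj: "A1 \<inter> A3 = {}"
    using finS by (auto simp: A1_def A3_def T3_set_def)
  have "{xs. length xs = c \<and> prime_zp_tbc_walk E xs} \<subseteq> S"
    by (auto simp: S_def prime_zp_tbc_walk_def zp_tbc_walk_def)
  then have "finite {xs. length xs = c \<and> prime_zp_tbc_walk E xs}" using finS by (rule finite_subset)
  then have "finite (T1_set E c)" by (simp add: T1_set_def quotient_def)
  then have "card A1 \<le> 2 * c * card (T1_set E c)"
    using c by (intro card_le_walk_classes) (auto simp: A1_def S_def)
  then have card_A1: "real (card A1) \<le> 2 * real c * T1"
    unfolding T1_def by (metis of_nat_le_iff of_nat_mult of_nat_numeral)
  have "finite (T3_set E c)" using finS by (simp add: T3_set_def tbc_classes_def quotient_def S_def)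
  then have "card A3 \<le> 2 * c * card (T3_set E c)"
    using c by (intro card_le_walk_classes) (auto simp: A3_def S_def)
  then have card_A3: "real (card A3) \<le> 2 * real c * T3"
    unfolding T3_def by (metis of_nat_le_iff of_nat_mult of_nat_numeral)
  \<comment> \<open>A zero-permutation walk is either prime or contains a zero-permutation subwalk,
    so its class lies in \<open>T1_set\<close> or \<open>T2_set\<close>.\<close>
  have A3_nonzero: "\<not> zero_perm xs" if "xs \<in> A3" for xs
  proof
    assume "zero_perm xs"
    with that have "?cls xs \<in> T1_set E c \<union> T2_set E c"
      by (auto simp: A3_def S_def T1_set_def T2_set_def prime_zp_tbc_walk_def zp_tbc_walk_def
          intro: quotientI)
    then show False using that by (simp add: A3_def T3_set_def)
  qed
  \<comment> \<open>A list with its class in \<open>T2_set\<close> shares that class with a walk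
    having a zero-permutation subwalk, and lifting is a property of the class.\<close>
  have rest: "xs \<in> A1 \<union> A3" if "has_cycle_lift U W E N p xs" "length xs = c" for xs N p
  proof (rule ccontr)
    assume "xs \<notin> A1 \<union> A3"
    moreover have S: "xs \<in> S"
      using tbc_walk_if_cycle_lift[OF G that(1)] that(2) c by (simp add: S_def)
    moreover have "?cls xs \<in> tbc_classes E c"
      using S unfolding tbc_classes_def S_def by (rule quotientI)
    ultimately have "?cls xs \<in> T2_set E c"
      by (auto simp: A1_def A3_def T3_set_def)
    then obtain ys where "?cls xs = ?cls ys" "has_zp_tbc_subwalk E ys"
      unfolding T2_set_def by (auto elim!: quotientE)
    then show False
      using that(1) has_cycle_lift_class_eq no_cycle_lift_if_zp_subwalk[OF G] by metis
  qed
  have "measure_pmf.variance (random_shifts E N)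
             (\<lambda>p. real (card (cycles (cyclic_lift U W E N p) c)))
           \<le> (real c ^ 3 / 2 * T1\<^sup>2 + real c / 4 * T3\<^sup>2 + real c / 2 * T1 * T3) * real N + 0"
    if N: "0 < N" for N
  proof -
    let ?M = "random_shifts E N" and ?lift = "\<lambda>p xs. has_cycle_lift U W E N p xs"
    let ?r = "real N / (2 * real c)"
    \<comment> \<open>\<open>B\<close> counts the lists of \<open>A1\<close> that fail to lift and
      \<open>D\<close> those of \<open>A3\<close> that do lift; the cycle count deviates from
      \<open>?r * card A1\<close> by \<open>?r * (D p - B p)\<close>.\<close>
    define B where "B = (\<lambda>p. \<Sum>xs\<in>A1. indicat_real {p. \<not> ?lift p xs} p)"
    define D where "D = (\<lambda>p. \<Sum>xs\<in>A3. indicat_real {p. ?lift p xs} p)"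
    have finM: "finite (set_pmf ?M)" using finite_edges[OF G] N by (rule finite_set_random_shifts)
    then have int: "integrable ?M f" for f :: "('a set \<Rightarrow> nat) \<Rightarrow> real"
      by (rule integrable_measure_pmf_finite)
    have X: "real (card (cycles (cyclic_lift U W E N p) c)) = ?r * (real (card A1) - B p + D p)" for p
    proof -
      let ?X = "{xs. length xs = c \<and> ?lift p xs}"
      have "?X = {xs \<in> A1 \<union> A3. ?lift p xs}"
        using rest by (auto simp: A1_def A3_def S_def)
      then have "real (card ?X) = (\<Sum>xs\<in>A1 \<union> A3. if ?lift p xs then 1 else 0)"
        using fin by (simp add: sum.If_cases Int_def conj_commute)
      also have "\<dots> = (\<Sum>xs\<in>A1. if ?lift p xs then 1 else 0) + D p"
        using fin disj by (simp add: sum.union_disjoint D_def indicator_def of_bool_def)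
      also have "(\<Sum>xs\<in>A1. if ?lift p xs then 1 else 0) = (\<Sum>xs\<in>A1. 1 - indicat_real {p. \<not> ?lift p xs} p)"
        by (intro sum.cong) auto
      also have "\<dots> = real (card A1) - B p" by (simp add: sum_subtractf B_def)
      finally have card_X: "real (card A1) - B p + D p = real (card ?X)" by simp
      have "2 * real c * real (card (cycles (cyclic_lift U W E N p) c)) = real N * real (card ?X)"
        using card_cycles_cyclic_lift[OF G N c(2), of p]
        by (metis of_nat_mult of_nat_numeral)
      then show ?thesis unfolding card_X using c by (simp add: field_simps)
    qed
    have EB: "measure_pmf.expectation ?M (\<lambda>p. (B p)\<^sup>2) \<le> (real (card A1))\<^sup>2 * (real c ^ 3 / 2 / real N)"
      unfolding B_def
    proof (rule expectation_square_sum_indicator_le[OF finM fin(1)])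
      fix xs assume "xs \<in> A1"
      \<comment> \<open>Class membership only provides some prime representative \<open>ys\<close>;
        the bound for \<open>ys\<close> carries over because the two lifting events
        coincide.\<close>
      then have "?cls xs \<in> {xs. length xs = c \<and> prime_zp_tbc_walk E xs} // walk_equiv"
        by (simp add: A1_def T1_set_def)
      then obtain ys where ys: "?cls xs = ?cls ys" "length ys = c" "prime_zp_tbc_walk E ys"
        by (elim quotientE) simp
      show "measure_pmf.prob ?M {p. \<not> ?lift p xs} \<le> real c ^ 3 / 2 / real N"
        using prob_no_cycle_lift_le[OF G N ys(3)] ys(2) by (simp add: has_cycle_lift_class_eq[OF ys(1)])
    qed
    have ED: "measure_pmf.expectation ?M (\<lambda>p. (D p)\<^sup>2) \<le> (real (card A3))\<^sup>2 * (real c / 4 / real N)"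
      unfolding D_def
    proof (rule expectation_square_sum_indicator_le[OF finM fin(2)])
      fix xs assume xs: "xs \<in> A3"
      then have "closed_walk E xs" "length xs = c" by (auto simp: A3_def S_def tbc_walk_def)
      then show "measure_pmf.prob ?M {p. ?lift p xs} \<le> real c / 4 / real N"
        using prob_cycle_lift_le[OF G N _ A3_nonzero[OF xs]] by simp
    qed
    have nonneg: "0 \<le> B p" "0 \<le> D p" for p by (simp_all add: B_def D_def sum_nonneg)
    have "(?r * (real (card A1) - B p + D p) - ?r * real (card A1))\<^sup>2 \<le> ?r\<^sup>2 * ((B p)\<^sup>2 + (D p)\<^sup>2)" for p
    proof -
      have "(D p - B p)\<^sup>2 \<le> (B p)\<^sup>2 + (D p)\<^sup>2"
        using nonneg[of p] by (simp add: power2_diff)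
      then have "?r\<^sup>2 * (D p - B p)\<^sup>2 \<le> ?r\<^sup>2 * ((B p)\<^sup>2 + (D p)\<^sup>2)" by (intro mult_left_mono) auto
      moreover have "?r * (real (card A1) - B p + D p) - ?r * real (card A1) = ?r * (D p - B p)"
        by (simp add: algebra_simps diff_divide_distrib add_divide_distrib)
      ultimately show ?thesis by (simp only: power_mult_distrib)
    qed
    then have "measure_pmf.variance ?M (\<lambda>p. real (card (cycles (cyclic_lift U W E N p) c)))
        \<le> measure_pmf.expectation ?M (\<lambda>p. ?r\<^sup>2 * ((B p)\<^sup>2 + (D p)\<^sup>2))"
      unfolding X by (intro order.trans[OF variance_pmf_le[OF finM]] integral_mono int)
    also have "\<dots> = ?r\<^sup>2 * (measure_pmf.expectation ?M (\<lambda>p. (B p)\<^sup>2) + measure_pmf.expectation ?M (\<lambda>p. (D p)\<^sup>2))"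
      by (simp add: int)
    also have "\<dots> \<le> ?r\<^sup>2 * ((2 * real c * T1)\<^sup>2 * (real c ^ 3 / 2 / real N) +
        (2 * real c * T3)\<^sup>2 * (real c / 4 / real N))"
    proof (intro mult_left_mono add_mono)
      show "measure_pmf.expectation ?M (\<lambda>p. (B p)\<^sup>2) \<le> (2 * real c * T1)\<^sup>2 * (real c ^ 3 / 2 / real N)"
        by (rule order.trans[OF EB]) (intro mult_right_mono power_mono card_A1, auto)
      show "measure_pmf.expectation ?M (\<lambda>p. (D p)\<^sup>2) \<le> (2 * real c * T3)\<^sup>2 * (real c / 4 / real N)"
        by (rule order.trans[OF ED]) (intro mult_right_mono power_mono card_A3, auto)
    qed auto
    \<comment> \<open>The factor (N / (2c))^2 cancels the (2c)^2 from the class sizes, and one N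
      cancels against the probabilities.\<close>
    also have "\<dots> = (real c ^ 3 / 2 * T1\<^sup>2 + real c / 4 * T3\<^sup>2) * real N"
      using N c(1) by (simp add: field_simps power2_eq_square)
    also have "\<dots> \<le> (real c ^ 3 / 2 * T1\<^sup>2 + real c / 4 * T3\<^sup>2 + real c / 2 * T1 * T3) * real N + 0"
      by (simp add: mult_right_mono T1_def T3_def)
    finally show ?thesis .
  qed
  then show ?thesis
    by (intro exI[of _ 0] eventually_mono[OF eventually_gt_at_top[of 0]])
qed

end
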